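(* Let $n\ge 2$ and let $\mathbbm{k}$ be a field with $\operatorname{char}(\mathbbm{k})\neq 2$. Let $N=2^{c_{n-1}}$, where $c_m=\binom{m}{2}$, and let $\phi_1,\dots,\phi_N$ be $\mathbb{Z}_2$-twistings of $R=\mathbbm{k}[x_{ij}:1\le i\le j\le n]$ such that \[J_n=\bigcap_{i=1}^N \phi_i(I_n)\] is a prime decomposition of $J_n$ with pairwise distinct components. Fix $l\in[N]$. If $n$ is odd, then \[\bigcap_{i\neq l}\phi_i(I_n)=J_n+\langle \phi_l(p^+_{n,i}) : i\in[n]\rangle,\] where $p^+_{n,i}\in R$ is homogeneous (in the standard grading) of degree $\frac{(n-1)^2}{2}$ and is the generating function of the fiber $V_n^{-1}[\mathbf b_i]$ with $\mathbf b_i=(n-2,\dots,n-2)+e_i$, in the sense that $p^+_{n,i}=\sum x^{\mathbf a}$ where $\mathbf a$ runs over one representative of each equivalence class of $V_n^{-1}[\mathbf b_i]$ modulo $L'_n$. If $n$ is even, then \[\bigcap_{i\neq l}\phi_i(I_n)=J_n+\langle \phi_l(p^+_{n})\rangle,\] where $p^+_n\in R$ is homogeneous of degree $\frac{n(n-2)}{2}$ and is the generating function of the fiber $V_n^{-1}[(n-2,\dots,n-2)]$ in the same sense (one monomial for each equivalence class of the fiber modulo $L'_n$).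
   Context: Let $\mathbbm{k}$ be a field, $n\ge 2$, $[n]=\{1,\dots,n\}$, and $R=\mathbbm{k}[x_{ij}: 1\le i\le j\le n]$ the polynomial ring in $\binom{n+1}{2}$ variables, with the convention $x_{ij}=x_{ji}$; exponent vectors live in $\mathbb{N}^{\binom{n+1}{2}}$ with standard basis $e_{ij}$ ($i\le j$, $e_{ij}=e_{ji}$). $V_n$ is the $n\times\binom{n+1}{2}$ integer matrix whose column indexed by $jk$ is $e_j+e_k\in\mathbb{Z}^n$ (so the $V_n$-degree of $x_{jk}$ is $e_j+e_k$). For $\mathbf b\in\mathbb{N}^n$, the fiber is $V_n^{-1}[\mathbf b]=\{u\in\mathbb{N}^{\binom{n+1}{2}}: V_nu=\mathbf b\}$. $I_n$ is the toric ideal of $V_n$, i.e. the ideal generated by all $2$-minors of the symmetric matrix $(x_{ij})$ (the second Veronese ideal). $J_n$ is the ideal generated by the principal $2$-minors $x_{ii}x_{jj}-x_{ij}^2$, $i,j\in[n]$. For $i,j,k,l\in[n]$ write $[ij|kl]=e_{ik}+e_{jl}-e_{il}-e_{jk}$; $L'_n\subset\mathbb{Z}^{\binom{n+1}{2}}$ is the lattice generated by the vectors $[ij|ij]$, $i,j\in[n]$. Two lattice points of a fiber are equivalent if their difference lies in $L'_n$. A $\mathbb{Z}_2$-twisting is a ring automorphism of $R$ mapping each variable either to itself or to its negative. *)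

theory Defs
  imports Main "HOL-Library.Poly_Mapping" "HOL-Library.Uprod" "HOL-Library.Cardinality"
begin

text \<open>Polynomial ring R = k[x_ij : i <= j] with index set [n] represented by a finite type 'n
  (n = CARD('n)); the variable x_ij = x_ji is indexed by the unordered pair Upair i j.
  Monomials (exponent vectors) are finitely supported maps 'n uprod to nat; polynomials are
  finitely supported maps from monomials to 'k.\<close>

type_synonym 'n mon = "'n uprod \<Rightarrow>\<^sub>0 nat"
type_synonym ('n, 'k) mpoly = "'n mon \<Rightarrow>\<^sub>0 'k"

definition Var :: "'n uprod \<Rightarrow> ('n, 'k::comm_ring_1) mpoly" where
  "Var v = Poly_Mapping.single (Poly_Mapping.single v 1) 1"

definition xv :: "'n \<Rightarrow> 'n \<Rightarrow> ('n, 'k::comm_ring_1) mpoly" where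
  "xv i j = Var (Upair i j)"

definition ideal_span :: "'a::comm_ring_1 set \<Rightarrow> 'a set" where
  "ideal_span S = {(\<Sum>s\<in>F. c s * s) | F c. finite F \<and> F \<subseteq> S}"

definition prime_ideal :: "'a::comm_ring_1 set \<Rightarrow> bool" where
  "prime_ideal P \<longleftrightarrow> ideal_span P = P \<and> P \<noteq> UNIV \<and>
     (\<forall>a b. a * b \<in> P \<longrightarrow> a \<in> P \<or> b \<in> P)"

text \<open>I_n: generated by all 2-minors of the symmetric matrix (x_ij).\<close>
definition I_n :: "('n, 'k::comm_ring_1) mpoly set" where
  "I_n = ideal_span {xv i k * xv j l - xv i l * xv j k | i j k l. True}"

text \<open>J_n: generated by the principal 2-minors.\<close>
definition J_n :: "('n, 'k::comm_ring_1) mpoly set" where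
  "J_n = ideal_span {xv i i * xv j j - (xv i j)^2 | i j. True}"

text \<open>Z_2-twisting: the k-algebra automorphism sending x_v to -x_v if s v, and to x_v otherwise.\<close>
definition twist :: "('n uprod \<Rightarrow> bool) \<Rightarrow> ('n, 'k::comm_ring_1) mpoly \<Rightarrow> ('n, 'k) mpoly" where
  "twist s p = (\<Sum>m::'n mon\<in>Poly_Mapping.keys p. Poly_Mapping.single m
      ((-1) ^ (\<Sum>v\<in>{v. s v} \<inter> Poly_Mapping.keys m. Poly_Mapping.lookup m v) * Poly_Mapping.lookup p m))"

text \<open>Multiplicity of index k in the pair v: V_n-degree of x_v is e_a + e_b.\<close>
definition pmult :: "'n \<Rightarrow> 'n uprod \<Rightarrow> nat" where
  "pmult k v = (if v = Upair k k then 2 else if k \<in> set_uprod v then 1 else 0)"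

definition Vdeg :: "'n mon \<Rightarrow> 'n \<Rightarrow> nat" where
  "Vdeg u k = (\<Sum>v\<in>Poly_Mapping.keys u. Poly_Mapping.lookup u v * pmult k v)"

definition fiber :: "('n \<Rightarrow> nat) \<Rightarrow> 'n mon set" where
  "fiber b = {u. Vdeg u = b}"

definition brk :: "'n \<Rightarrow> 'n \<Rightarrow> 'n uprod \<Rightarrow> int" where
  "brk i j = (\<lambda>v. (if v = Upair i i then 1 else 0) + (if v = Upair j j then 1 else 0)
                 - 2 * (if v = Upair i j then 1 else 0))"

definition Lprime :: "('n::finite uprod \<Rightarrow> int) set" where
  "Lprime = {(\<lambda>v. \<Sum>ij\<in>UNIV. c ij * brk (fst ij) (snd ij) v) | c. True}"

definition lat_equiv :: "'n::finite mon \<Rightarrow> 'n mon \<Rightarrow> bool" where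
  "lat_equiv u w \<longleftrightarrow> (\<lambda>v. int (Poly_Mapping.lookup u v) - int (Poly_Mapping.lookup w v)) \<in> Lprime"

definition is_genfun :: "'n::finite mon set \<Rightarrow> ('n, 'k::comm_ring_1) mpoly \<Rightarrow> bool" where
  "is_genfun F p \<longleftrightarrow> (\<exists>A. A \<subseteq> F \<and> finite A \<and> (\<forall>u\<in>F. \<exists>!a\<in>A. lat_equiv u a) \<and>
      p = (\<Sum>a\<in>A. Poly_Mapping.single a 1))"

definition tdeg :: "'n mon \<Rightarrow> nat" where
  "tdeg m = (\<Sum>v\<in>Poly_Mapping.keys m. Poly_Mapping.lookup m v)"

definition homogeneous_of :: "nat \<Rightarrow> ('n, 'k::comm_ring_1) mpoly \<Rightarrow> bool" where
  "homogeneous_of d p \<longleftrightarrow> (\<forall>m\<in>Poly_Mapping.keys p. tdeg m = d)"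

end

theory Submission
  imports Defs
begin

text \<open>A polynomial lies in a twisted component \<open>\<phi>(I\<^sub>n)\<close> iff in every \<open>V\<^sub>n\<close>-degree the sum
  of its coefficients, weighted by the signs of \<open>\<phi>\<close>, vanishes. Fix a vertex \<open>r\<close>. Within the fiber of \<open>\<^bold>b\<close>
  the class of a monomial modulo \<open>L'\<^sub>n\<close> is the set \<open>H\<close> of edges of the complete graph on \<open>[n] - {r}\<close> with
  odd exponent, and up to a global sign the signs of \<open>\<phi>\<close> on the fiber are a Walsh character \<open>H \<mapsto> (-1)^|E \<inter> H|\<close>.
  Since there are as many components as such characters, every \<open>E\<close> occurs exactly once. If all \<open>b\<^sub>k \<ge> n - 2\<close>
  (and the sum of the \<open>b\<^sub>k\<close> is even), every \<open>H\<close> is realised in the fiber, so modulo \<open>J\<^sub>n\<close> a homogeneous polynomial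
  killed by all characters but one is a scalar multiple of that character, i.e. of the twisted generating function.
  If some \<open>b\<^sub>k < n - 2\<close>, the star at \<open>k\<close> is not realised, and the linear relation
  between the characters obtained by evaluating at this missing \<open>H\<close> shows that vanishing under all characters
  but one forces vanishing under the last.\<close>

section \<open>Weighted coefficient sums and twistings\<close>

instance uprod :: (finite) finite
  by standard simp

text \<open>The linear functional on polynomials with value \<open>h m\<close> at the monomial
  \<open>m\<close>. Coefficients, twists and signed fiber sums are all handled through it, so
  products need to be treated only once, in \<open>wsum_mult\<close>.\<close>

definition wsum :: "('a \<Rightarrow> 'k) \<Rightarrow> ('a \<Rightarrow>\<^sub>0 'k) \<Rightarrow> 'k::comm_ring_1" where
  "wsum h f = (\<Sum>m\<in>Poly_Mapping.keys f. h m * Poly_Mapping.lookup f m)"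

lemma wsum_superset:
  assumes "finite M" "Poly_Mapping.keys f \<subseteq> M"
  shows "wsum h f = (\<Sum>m\<in>M. h m * Poly_Mapping.lookup f m)"
  unfolding wsum_def using assms
  by (intro sum.mono_neutral_left) (auto simp: in_keys_iff)

lemma wsum_single [simp]: "wsum h (Poly_Mapping.single m c) = h m * c"
  by (subst wsum_superset[of "{m}"]) auto

lemma wsum_zero [simp]: "wsum h 0 = 0"
  by (simp add: wsum_def)

lemma wsum_add: "wsum h (f + g) = wsum h f + wsum h g"
  unfolding wsum_def by (rule setsum_keys_plus_distrib) (auto simp: algebra_simps)

lemma wsum_uminus: "wsum h (- f) = - wsum h f"
  using wsum_add[of h f "- f"] by (simp add: eq_neg_iff_add_eq_0 add.commute)

lemma wsum_diff: "wsum h (f - g) = wsum h f - wsum h g"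
  using wsum_add[of h f "- g"] by (simp add: wsum_uminus)

lemma wsum_sum: "wsum h (\<Sum>i\<in>X. f i) = (\<Sum>i\<in>X. wsum h (f i))"
  by (induction X rule: infinite_finite_induct) (auto simp: wsum_add)

lemma sum_monomials:
  "(\<Sum>m\<in>Poly_Mapping.keys f. Poly_Mapping.single m (Poly_Mapping.lookup f m)) = f"
  by (rule poly_mapping_eqI) (auto simp: lookup_sum lookup_single when_def in_keys_iff sum.delta)

lemma wsum_weight_cmult: "wsum (\<lambda>m. c * h m) f = c * wsum h f"
  by (simp add: wsum_def sum_distrib_left mult.assoc)

lemma wsum_weight_sum: "wsum (\<lambda>m. \<Sum>i\<in>X. h i m) f = (\<Sum>i\<in>X. wsum (h i) f)"
  unfolding wsum_def sum_distrib_right by (rule sum.swap)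

text \<open>Both sides are linear in \<open>f\<close> and in \<open>g\<close>, so it suffices to
  compare them on monomials, where exponents add.\<close>

lemma wsum_mult:
  "wsum h (f * g) = wsum (\<lambda>m. wsum (\<lambda>m'. h (m + m')) g) f"
proof -
  have mono: "wsum h (Poly_Mapping.single m c * g) = wsum (\<lambda>m'. h (m + m')) g * c" for m c
  proof -
    have "wsum h (Poly_Mapping.single m c * g) = wsum h (Poly_Mapping.single m c *
        (\<Sum>m'\<in>Poly_Mapping.keys g. Poly_Mapping.single m' (Poly_Mapping.lookup g m')))"
      by (simp add: sum_monomials)
    also have "\<dots> = wsum (\<lambda>m'. h (m + m')) g * c"
      by (simp add: sum_distrib_left mult_single wsum_sum)
        (simp add: wsum_def sum_distrib_left sum_distrib_right mult_ac)
    finally show ?thesis .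
  qed
  have "wsum h (f * g) = wsum h ((\<Sum>m\<in>Poly_Mapping.keys f.
      Poly_Mapping.single m (Poly_Mapping.lookup f m)) * g)"
    by (simp add: sum_monomials)
  also have "\<dots> = wsum (\<lambda>m. wsum (\<lambda>m'. h (m + m')) g) f"
    by (simp add: sum_distrib_right wsum_sum mono) (simp add: wsum_def)
  finally show ?thesis .
qed

section \<open>Multidegree and total degree of monomials\<close>

lemma Vdeg_UNIV:
  fixes u :: "'n::finite mon"
  shows "Vdeg u k = (\<Sum>v\<in>UNIV. Poly_Mapping.lookup u v * pmult k v)"
  unfolding Vdeg_def by (rule sum.mono_neutral_left) (auto simp: in_keys_iff)

lemma Vdeg_add: "Vdeg (u + w) k = Vdeg u k + Vdeg (w :: 'n::finite mon) k"
  by (simp add: Vdeg_UNIV lookup_add algebra_simps sum.distrib)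

lemma Vdeg_zero [simp]: "Vdeg 0 = (\<lambda>_. 0)"
  by (auto simp: Vdeg_def)

lemma Vdeg_single [simp]: "Vdeg (Poly_Mapping.single v c) k = c * pmult k v"
  by (cases "c = 0") (auto simp: Vdeg_def)

lemma pmult_Upair: "pmult k (Upair i j) = of_bool (k = i) + of_bool (k = j)"
  by (auto simp: pmult_def)

lemma sum_pmult:
  fixes v :: "'n::finite uprod"
  shows "(\<Sum>k\<in>UNIV. pmult k v) = 2"
  by (cases v) (simp add: pmult_Upair sum.distrib of_bool_def)

lemma tdeg_UNIV:
  fixes u :: "'n::finite mon"
  shows "tdeg u = (\<Sum>v\<in>UNIV. Poly_Mapping.lookup u v)"
  unfolding tdeg_def by (rule sum.mono_neutral_left) (auto simp: in_keys_iff)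

lemma sum_Vdeg:
  fixes u :: "'n::finite mon"
  shows "(\<Sum>k\<in>UNIV. Vdeg u k) = 2 * tdeg u"
proof -
  have "(\<Sum>k\<in>UNIV. Vdeg u k) = (\<Sum>v\<in>UNIV. \<Sum>k\<in>UNIV. Poly_Mapping.lookup u v * pmult k v)"
    unfolding Vdeg_UNIV by (rule sum.swap)
  also have "\<dots> = (\<Sum>v\<in>UNIV. Poly_Mapping.lookup u v * 2)"
    by (simp add: sum_pmult flip: sum_distrib_left)
  finally show ?thesis by (simp add: tdeg_UNIV sum_distrib_left mult.commute)
qed

lemma tdeg_cong: "Vdeg u = Vdeg w \<Longrightarrow> tdeg u = tdeg (w :: 'n::finite mon)"
  using sum_Vdeg[of u] sum_Vdeg[of w] by simp

lemma mon_induct [case_names zero add]: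
  fixes u :: "'v::finite \<Rightarrow>\<^sub>0 nat"
  assumes "P 0" "\<And>u v. P u \<Longrightarrow> P (Poly_Mapping.single v 1 + u)"
  shows "P u"
proof (induction "\<Sum>v\<in>UNIV. Poly_Mapping.lookup u v" arbitrary: u)
  case 0
  then have "u = 0" by (intro poly_mapping_eqI) simp
  then show ?case using assms by simp
next
  case (Suc t)
  then obtain v where v: "Poly_Mapping.lookup u v \<noteq> 0"
    by (metis sum.neutral nat.distinct(1))
  define w where "w = u - Poly_Mapping.single v 1"
  have u: "u = Poly_Mapping.single v 1 + w"
    using v by (intro poly_mapping_eqI) (auto simp: w_def lookup_add lookup_minus lookup_single when_def)
  have "t = (\<Sum>v\<in>UNIV. Poly_Mapping.lookup w v)"
    using Suc(2) unfolding u by (simp add: lookup_add sum.distrib lookup_single when_def)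
  then show ?case using Suc(1) assms(2) u by metis
qed

section \<open>Signs of monomials and twistings\<close>

definition sgn_of :: "bool \<Rightarrow> 'k::comm_ring_1" where
  "sgn_of b = (if b then - 1 else 1)"

lemma sgn_of_sq [simp]: "sgn_of b * sgn_of b = 1"
  by (simp add: sgn_of_def)

lemma sgn_of_power: "sgn_of b ^ n = sgn_of (b \<and> odd n)"
  by (simp add: sgn_of_def)

text \<open>The product runs over all variables instead of the support, which makes multiplicativity
  in \<open>m\<close> immediate.\<close>

definition msign :: "('v::finite \<Rightarrow> bool) \<Rightarrow> ('v \<Rightarrow>\<^sub>0 nat) \<Rightarrow> 'k::comm_ring_1" where
  "msign s m = (\<Prod>v\<in>UNIV. sgn_of (s v) ^ Poly_Mapping.lookup m v)"

lemma msign_add: "msign s (u + w) = msign s u * msign s w"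
  by (simp add: msign_def lookup_add power_add prod.distrib)

lemma msign_sq [simp]: "msign s u * msign s u = 1"
  by (simp add: msign_def sgn_of_power flip: prod.distrib)

lemma msign_neq_0 [simp]: "msign s u \<noteq> (0 :: 'k::comm_ring_1)"
proof
  assume "msign s u = (0 :: 'k)"
  then have "msign s u * msign s u = (0 :: 'k)" by simp
  then show False by simp
qed

lemma msign_single [simp]:
  "msign s (Poly_Mapping.single v c) = (sgn_of (s v) ^ c :: 'k::comm_ring_1)"
proof -
  have "sgn_of (s w) ^ (c when v = w) = (if w = v then sgn_of (s v) ^ c else 1 :: 'k)" for w
    by auto
  then have "msign s (Poly_Mapping.single v c) = (\<Prod>w\<in>UNIV. if w = v then sgn_of (s v) ^ c else 1 :: 'k)"
    unfolding msign_def lookup_single by (intro prod.cong) auto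
  then show ?thesis by simp
qed

lemma msign_False [simp]: "msign (\<lambda>_. False) u = 1"
  by (simp add: msign_def sgn_of_def)

lemma lookup_twist:
  fixes p :: "('n::finite, 'k::comm_ring_1) mpoly"
  shows "Poly_Mapping.lookup (twist s p) m = msign s m * Poly_Mapping.lookup p m"
proof -
  have "(-1) ^ (\<Sum>v\<in>{v. s v} \<inter> Poly_Mapping.keys m. Poly_Mapping.lookup m v) = (msign s m :: 'k)" for m
  proof -
    have "msign s m = (\<Prod>v\<in>{v. s v} \<inter> Poly_Mapping.keys m. sgn_of (s v) ^ Poly_Mapping.lookup m v :: 'k)"
      unfolding msign_def by (rule prod.mono_neutral_right) (auto simp: in_keys_iff sgn_of_def)
    then show ?thesis by (simp add: power_sum sgn_of_def)
  qed
  then show ?thesis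
    unfolding twist_def by (auto simp: lookup_sum lookup_single when_def in_keys_iff sum.delta)
qed

lemma keys_twist [simp]:
  fixes p :: "('n::finite, 'k::comm_ring_1) mpoly"
  shows "Poly_Mapping.keys (twist s p) = Poly_Mapping.keys p"
proof -
  have "msign s m * c = 0 \<longleftrightarrow> c = 0" for c :: 'k and m
    by (metis msign_sq mult.assoc mult_1 mult_zero_right)
  then show ?thesis by (auto simp: in_keys_iff lookup_twist)
qed

lemma twist_twist [simp]: "twist s (twist s p) = (p :: ('n::finite, 'k::comm_ring_1) mpoly)"
  by (rule poly_mapping_eqI) (simp add: lookup_twist flip: mult.assoc)

lemma wsum_twist:
  fixes p :: "('n::finite, 'k::comm_ring_1) mpoly"
  shows "wsum h (twist s p) = wsum (\<lambda>m. h m * msign s m) p"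
  by (simp add: wsum_def lookup_twist mult.assoc)

lemma lookup_conv_wsum: "Poly_Mapping.lookup f m = wsum (\<lambda>x. of_bool (x = m)) f"
  by (auto simp: wsum_def in_keys_iff of_bool_def sum.delta if_distrib[of "\<lambda>x. x * _"] cong: if_cong)

text \<open>A coefficient of a product is an iterated \<open>wsum\<close>; since
  \<open>msign\<close> is multiplicative, the signs of the two factors combine to the sign of the
  product monomial.\<close>

lemma twist_mult:
  "twist s (p * q) = twist s p * twist s (q :: ('n::finite, 'k::comm_ring_1) mpoly)"
proof (rule poly_mapping_eqI)
  fix m
  have eq: "of_bool (x + y = m) * msign s x * msign s y = msign s m * (of_bool (x + y = m) :: 'k)" for x y
    by (auto simp: of_bool_def msign_add)
  have "Poly_Mapping.lookup (twist s p * twist s q) m =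
      wsum (\<lambda>x. wsum (\<lambda>y. of_bool (x + y = m) * msign s x * msign s y) q) p"
    unfolding lookup_conv_wsum[of "twist s p * twist s q"] wsum_mult wsum_twist
    by (simp add: wsum_def sum_distrib_left sum_distrib_right mult_ac)
  also have "\<dots> = msign s m * Poly_Mapping.lookup (p * q) m"
    unfolding eq wsum_weight_cmult by (simp add: lookup_conv_wsum wsum_mult)
  finally show "Poly_Mapping.lookup (twist s (p * q)) m = Poly_Mapping.lookup (twist s p * twist s q) m"
    by (simp add: lookup_twist)
qed

lemma mem_twist_image: "f \<in> twist s ` S \<longleftrightarrow> twist s f \<in> (S :: ('n::finite, 'k::comm_ring_1) mpoly set)"
  by (metis image_iff twist_twist)

section \<open>Closure properties of generated ideals\<close>

lemma ideal_span_superset: "S \<subseteq> ideal_span S"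
proof
  fix x assume "x \<in> S"
  then show "x \<in> ideal_span S"
    unfolding ideal_span_def by (auto intro!: exI[of _ "{x}"] exI[of _ "\<lambda>_. 1"])
qed

lemma ideal_span_mult: "x \<in> ideal_span S \<Longrightarrow> a * x \<in> ideal_span S"
  unfolding ideal_span_def
  by (fastforce simp: sum_distrib_left mult.assoc[symmetric] intro: exI[of _ "\<lambda>s. a * _ s"])

lemma ideal_span_add:
  assumes "x \<in> ideal_span S" "y \<in> ideal_span S"
  shows "x + y \<in> ideal_span S"
proof -
  obtain F c where F: "finite F" "F \<subseteq> S" "x = (\<Sum>s\<in>F. c s * s)"
    using assms unfolding ideal_span_def by auto
  obtain G d where G: "finite G" "G \<subseteq> S" "y = (\<Sum>s\<in>G. d s * s)"
    using assms unfolding ideal_span_def by auto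
  \<comment> \<open>Extending the coefficients by zero lets both combinations run over one finite
    set.\<close>
  define c' where "c' s = (if s \<in> F then c s else 0)" for s
  define d' where "d' s = (if s \<in> G then d s else 0)" for s
  have "x = (\<Sum>s\<in>F\<union>G. c' s * s)" "y = (\<Sum>s\<in>F\<union>G. d' s * s)"
    using F G by (auto simp: c'_def d'_def intro!: sum.mono_neutral_cong_left)
  then have "x + y = (\<Sum>s\<in>F\<union>G. (c' s + d' s) * s)"
    by (simp add: distrib_right sum.distrib)
  then show ?thesis
    unfolding ideal_span_def using F G by (auto intro!: exI[of _ "F\<union>G"] exI[of _ "\<lambda>s. c' s + d' s"])
qed

lemma ideal_span_zero: "0 \<in> ideal_span S"
  unfolding ideal_span_def by (auto intro!: exI[of _ "{}"])

lemma ideal_span_sum: "(\<And>i. i \<in> X \<Longrightarrow> f i \<in> ideal_span S) \<Longrightarrow> (\<Sum>i\<in>X. f i) \<in> ideal_span S"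
  by (induction X rule: infinite_finite_induct) (auto intro: ideal_span_zero ideal_span_add)

lemma ideal_span_diff: "x \<in> ideal_span S \<Longrightarrow> y \<in> ideal_span S \<Longrightarrow> x - y \<in> ideal_span S"
  using ideal_span_add[of x S "(- 1) * y"] ideal_span_mult[of y S "- 1"] by simp

lemma ideal_span_mono: "S \<subseteq> T \<Longrightarrow> ideal_span S \<subseteq> ideal_span T"
  unfolding ideal_span_def by blast

section \<open>The components as kernels of signed fiber sums\<close>

definition fibsum :: "('n uprod \<Rightarrow> bool) \<Rightarrow> ('n \<Rightarrow> nat) \<Rightarrow> ('n::finite, 'k::comm_ring_1) mpoly \<Rightarrow> 'k" where
  "fibsum s b = wsum (\<lambda>m. of_bool (Vdeg m = b) * msign s m)"

lemma xv_mult_xv: "xv i j * xv k l =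
    Poly_Mapping.single (Poly_Mapping.single (Upair i j) 1 + Poly_Mapping.single (Upair k l) 1) 1"
  by (simp add: xv_def Var_def mult_single)

text \<open>The two terms of a 2-minor have the same \<open>Vdeg\<close>, also after multiplication
  by a monomial, so a functional that sees only the degree vanishes on all multiples of the
  generators.\<close>

lemma wsum_I_n:
  fixes h :: "('n::finite \<Rightarrow> nat) \<Rightarrow> 'k::comm_ring_1"
  assumes "f \<in> I_n"
  shows "wsum (\<lambda>m. h (Vdeg m)) f = 0"
proof -
  have gen: "wsum (\<lambda>m. h (Vdeg m)) (c * (xv i k * xv j l - xv i l * xv j k)) = 0"
    for c :: "('n, 'k) mpoly" and i j k l
  proof -
    have "Vdeg (m + (Poly_Mapping.single (Upair i k) 1 + Poly_Mapping.single (Upair j l) 1)) =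
       Vdeg (m + (Poly_Mapping.single (Upair i l) 1 + Poly_Mapping.single (Upair j k) 1))" for m
      by (rule ext) (simp add: Vdeg_add pmult_Upair)
    then have "wsum (\<lambda>m'. h (Vdeg (m + m'))) (xv i k * xv j l - xv i l * xv j k) = 0" for m
      unfolding xv_mult_xv wsum_diff wsum_single by simp
    then show ?thesis by (simp add: wsum_mult) (simp add: wsum_def)
  qed
  from assms obtain F c where F: "F \<subseteq> {xv i k * xv j l - xv i l * xv j k | i j k l. True}"
    and f: "f = (\<Sum>x\<in>F. c x * x)"
    unfolding I_n_def ideal_span_def by auto
  show ?thesis unfolding f wsum_sum
    by (rule sum.neutral) (use F gen in auto)
qed

lemma xv_power: "xv i j ^ t = Poly_Mapping.single (Poly_Mapping.single (Upair i j) t) (1 :: 'k::comm_ring_1)"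
  by (induction t) (auto simp: xv_def Var_def mult_single simp flip: single_add)

text \<open>Modulo the minors, multiplying by \<open>x\<^sub>r\<^sub>r\<close> splits \<open>x\<^sub>j\<^sub>k\<close> into \<open>x\<^sub>r\<^sub>j x\<^sub>r\<^sub>k\<close>.\<close>

lemma mult_xv_power_I_n:
  fixes u :: "'n::finite mon" and r :: 'n
  shows "xv r r ^ tdeg u * Poly_Mapping.single u 1 - (\<Prod>j\<in>UNIV. xv r j ^ Vdeg u j) \<in> (I_n :: ('n, 'k::comm_ring_1) mpoly set)"
proof (induction u rule: mon_induct)
  case zero
  then show ?case by (simp add: tdeg_def I_n_def ideal_span_zero)
next
  case (add u v)
  obtain j k where v: "v = Upair j k" by (cases v) auto
  define M :: "('n, 'k) mpoly" where "M = (\<Prod>j\<in>UNIV. xv r j ^ Vdeg u j)"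
  have "(\<Prod>i\<in>UNIV. xv r i ^ pmult i v) = (xv r j * xv r k :: ('n, 'k) mpoly)"
  proof -
    have "xv r i ^ of_bool (i = a) = (if i = a then xv r a else 1 :: ('n, 'k) mpoly)" for i a
      by simp
    then show ?thesis by (simp add: v pmult_Upair power_add prod.distrib)
  qed
  then have M: "(\<Prod>i\<in>UNIV. xv r i ^ Vdeg (Poly_Mapping.single v 1 + u) i) = xv r j * xv r k * M"
    by (simp add: Vdeg_add power_add prod.distrib M_def)
  have t: "tdeg (Poly_Mapping.single v 1 + u) = Suc (tdeg u)"
    by (simp add: tdeg_UNIV lookup_add sum.distrib lookup_single when_def)
  have s: "Poly_Mapping.single (Poly_Mapping.single v 1 + u) 1 = xv j k * Poly_Mapping.single u (1 :: 'k)"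
    by (simp add: xv_def Var_def v mult_single)
  have "xv r r * xv j k - xv r k * xv j r \<in> (I_n :: ('n, 'k) mpoly set)"
    unfolding I_n_def by (rule subsetD[OF ideal_span_superset]) blast
  moreover have "xv j r = (xv r j :: ('n, 'k) mpoly)"
    unfolding xv_def by (rule arg_cong[of _ _ Var]) simp
  \<comment> \<open>One minor exchanges the new variable, and the induction hypothesis exchanges the
    rest; the two mixed terms cancel.\<close>
  ultimately have "M * (xv r r * xv j k - xv r k * xv r j) +
      (xv r r * xv j k) * (xv r r ^ tdeg u * Poly_Mapping.single u 1 - M) \<in> (I_n :: ('n, 'k) mpoly set)"
    using add unfolding I_n_def M_def[symmetric]
    by (intro ideal_span_add ideal_span_mult) auto
  then show ?case unfolding M t s by (simp add: algebra_simps)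
qed

text \<open>By \<open>mult_xv_power_I_n\<close>, multiplying by a power of x_rr makes the two
  monomials congruent. Primality cancels this power, which is not in \<open>I_n\<close> because its
  coefficient sum is 1.\<close>

lemma single_diff_I_n:
  fixes u w :: "'n::finite mon"
  assumes "prime_ideal (I_n :: ('n, 'k::comm_ring_1) mpoly set)" and "Vdeg u = Vdeg w"
  shows "Poly_Mapping.single u 1 - Poly_Mapping.single w 1 \<in> (I_n :: ('n, 'k) mpoly set)"
proof -
  fix r :: 'n
  define t where "t = tdeg u"
  have "xv r r ^ t * (Poly_Mapping.single u 1 - Poly_Mapping.single w 1) \<in> (I_n :: ('n, 'k) mpoly set)"
    using ideal_span_diff mult_xv_power_I_n[of r u] mult_xv_power_I_n[of r w] tdeg_cong[OF assms(2)]
    unfolding assms(2) I_n_def t_def by (fastforce simp: algebra_simps)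
  moreover have "xv r r ^ t \<notin> (I_n :: ('n, 'k) mpoly set)"
    using wsum_I_n[of "xv r r ^ t" "\<lambda>_. 1 :: 'k"] by (auto simp: xv_power)
  ultimately show ?thesis using assms(1) unfolding prime_ideal_def by blast
qed

text \<open>For the converse direction, move each monomial of \<open>f\<close> to a chosen monomial
  \<open>w b\<close> of its degree \<open>b\<close>. The coefficients collected there are the fiber
  sums, so the moved polynomial is 0 and \<open>f\<close> is a combination of differences covered by
  \<open>single_diff_I_n\<close>.\<close>

lemma I_n_iff:
  fixes f :: "('n::finite, 'k::comm_ring_1) mpoly"
  assumes "prime_ideal (I_n :: ('n, 'k) mpoly set)"
  shows "f \<in> I_n \<longleftrightarrow> (\<forall>b. fibsum (\<lambda>_. False) b f = 0)"
proof
  assume "f \<in> I_n"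
  then show "\<forall>b. fibsum (\<lambda>_. False) b f = 0"
    using wsum_I_n[of f "\<lambda>c. of_bool (c = _)"] by (simp add: fibsum_def)
next
  assume f: "\<forall>b. fibsum (\<lambda>_. False) b f = 0"
  define w :: "('n \<Rightarrow> nat) \<Rightarrow> 'n mon" where "w b = (SOME u. Vdeg u = b)" for b
  have w: "Vdeg (w (Vdeg u)) = Vdeg u" for u
    unfolding w_def by (rule someI_ex) blast
  let ?K = "Poly_Mapping.keys f"
  have "(\<Sum>m\<in>?K. Poly_Mapping.single (w (Vdeg m)) (Poly_Mapping.lookup f m)) = 0"
  proof -
    have "(\<Sum>m\<in>{m\<in>?K. Vdeg m = b}. Poly_Mapping.single (w (Vdeg m)) (Poly_Mapping.lookup f m)) = 0" for b
    proof -
      have "(\<Sum>m\<in>{m\<in>?K. Vdeg m = b}. Poly_Mapping.single (w (Vdeg m)) (Poly_Mapping.lookup f m))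
         = Poly_Mapping.single (w b) (\<Sum>m\<in>{m\<in>?K. Vdeg m = b}. Poly_Mapping.lookup f m)"
        by (rule poly_mapping_eqI) (auto simp: lookup_sum lookup_single when_def)
      also have "(\<Sum>m\<in>{m\<in>?K. Vdeg m = b}. Poly_Mapping.lookup f m) = fibsum (\<lambda>_. False) b f"
        unfolding fibsum_def wsum_def by (rule sum.mono_neutral_cong_left) auto
      finally show ?thesis using f by simp
    qed
    then show ?thesis
      by (subst sum.image_gen[of _ _ Vdeg]) auto
  qed
  then have "f = (\<Sum>m\<in>?K. Poly_Mapping.single m (Poly_Mapping.lookup f m))
      - (\<Sum>m\<in>?K. Poly_Mapping.single (w (Vdeg m)) (Poly_Mapping.lookup f m))"
    by (simp add: sum_monomials)
  also have "\<dots> = (\<Sum>m\<in>?K. Poly_Mapping.single 0 (Poly_Mapping.lookup f m) *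
      (Poly_Mapping.single m 1 - Poly_Mapping.single (w (Vdeg m)) 1))"
    by (simp add: sum_subtractf right_diff_distrib mult_single)
  also have "\<dots> \<in> I_n"
    using single_diff_I_n[OF assms] w unfolding I_n_def
    by (intro ideal_span_sum ideal_span_mult) auto
  finally show "f \<in> I_n" .
qed

text \<open>Twisting is a multiplicative involution, so primality of one component carries back to
  \<open>I_n\<close>, where the fiber sum criterion is proved.\<close>

lemma prime_ideal_I_n_if_twist:
  assumes "prime_ideal (twist s ` (I_n :: ('n::finite, 'k::comm_ring_1) mpoly set))"
  shows "prime_ideal (I_n :: ('n, 'k) mpoly set)"
  unfolding prime_ideal_def
proof (intro conjI allI impI)
  show "ideal_span I_n = (I_n :: ('n, 'k) mpoly set)"
  proof
    show "ideal_span I_n \<subseteq> (I_n :: ('n, 'k) mpoly set)"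
    proof
      fix f :: "('n, 'k) mpoly" assume "f \<in> ideal_span I_n"
      then show "f \<in> I_n"
        unfolding ideal_span_def[of I_n]
        by (auto simp: I_n_def intro!: ideal_span_sum ideal_span_mult)
    qed
  qed (rule ideal_span_superset)
  have "twist s ` (I_n :: ('n, 'k) mpoly set) \<noteq> UNIV"
    using assms unfolding prime_ideal_def by blast
  then show "(I_n :: ('n, 'k) mpoly set) \<noteq> UNIV"
    using mem_twist_image[of _ s "UNIV :: ('n, 'k) mpoly set"] by auto
next
  fix a b :: "('n, 'k) mpoly" assume "a * b \<in> I_n"
  then have "twist s a * twist s b \<in> twist s ` I_n"
    by (simp add: mem_twist_image twist_mult)
  then show "a \<in> I_n \<or> b \<in> I_n"
    using assms unfolding prime_ideal_def mem_twist_image twist_twist by (metis mem_twist_image twist_twist)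
qed

lemma twist_I_n_iff:
  fixes f :: "('n::finite, 'k::comm_ring_1) mpoly"
  assumes "prime_ideal (I_n :: ('n, 'k) mpoly set)"
  shows "f \<in> twist s ` I_n \<longleftrightarrow> (\<forall>b. fibsum s b f = 0)"
  unfolding mem_twist_image I_n_iff[OF assms] by (simp add: fibsum_def wsum_twist)

section \<open>Walsh characters on edge sets\<close>

definition edges :: "'n \<Rightarrow> 'n uprod set" where
  "edges r = {v. proper_uprod v \<and> r \<notin> set_uprod v}"

definition oddedges :: "'n \<Rightarrow> 'n mon \<Rightarrow> 'n uprod set" where
  "oddedges r u = {v \<in> edges r. odd (Poly_Mapping.lookup u v)}"

text \<open>For finite \<open>E\<close> this is -1 to the power of the size of the intersection. The
  product over \<open>E\<close> is what lets a sum over all \<open>E\<close> factor in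
  \<open>walsh_orthogonal\<close>.\<close>

definition walsh :: "'a set \<Rightarrow> 'a set \<Rightarrow> 'k::comm_ring_1" where
  "walsh E H = (\<Prod>v\<in>E. sgn_of (v \<in> H))"

lemma walsh_commute:
  assumes "finite E" "finite H"
  shows "walsh E H = (walsh H E :: 'k::comm_ring_1)"
proof -
  have "walsh A B = (\<Prod>v\<in>A \<inter> B. - 1 :: 'k)" if "finite A" for A B :: "'a set"
    unfolding walsh_def using that
    by (intro prod.mono_neutral_cong_right) (auto simp: sgn_of_def)
  from this[of E H] this[of H E] assms show ?thesis
    by (metis Int_commute)
qed

lemma walsh_sq [simp]: "walsh E H * walsh E H = 1"
  by (simp add: walsh_def flip: prod.distrib)

text \<open>The sum over subsets factors into one term per element of \<open>F\<close>: it is 1 + 1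
  where \<open>A\<close> and \<open>B\<close> agree and -1 + 1 where they differ.\<close>

lemma walsh_orthogonal:
  assumes "finite F" "A \<subseteq> F" "B \<subseteq> F"
  shows "(\<Sum>E\<in>Pow F. walsh E A * walsh E B) = (if A = B then 2 ^ card F else 0 :: 'k::comm_ring_1)"
proof -
  have "(\<Sum>E\<in>Pow F. walsh E A * walsh E B) = (\<Prod>v\<in>F. sgn_of (v \<in> A) * sgn_of (v \<in> B) + 1 :: 'k)"
    using assms by (simp add: prod_add walsh_def prod.distrib)
  also have "\<dots> = (if A = B then 2 ^ card F else 0)"
  proof (cases "A = B")
    case False
    then obtain v where "v \<in> F" "(v \<in> A) \<noteq> (v \<in> B)"
      using assms by blast
    then show ?thesis
      using False assms by (auto intro!: prod_zero bexI[of _ v] simp: sgn_of_def)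
  qed simp
  finally show ?thesis .
qed

text \<open>With this count the number of components equals the number of subsets of
  \<open>edges r\<close>.\<close>

lemma card_edges: "card (edges (r :: 'n::finite)) = (CARD('n) - 1) choose 2"
proof -
  have "bij_betw set_uprod (edges r) {X. X \<subseteq> UNIV - {r} \<and> card X = 2}"
  proof (rule bij_betw_imageI)
    show "inj_on set_uprod (edges r)"
    proof (rule inj_onI)
      fix v w assume "v \<in> edges r" "w \<in> edges r" "set_uprod v = set_uprod w"
      then show "v = w"
        by (cases v; cases w) (auto simp: doubleton_eq_iff)
    qed
    show "set_uprod ` edges r = {X. X \<subseteq> UNIV - {r} \<and> card X = 2}"
    proof (intro equalityI subsetI)
      fix X assume "X \<in> set_uprod ` edges r"
      then obtain v where "v \<in> edges r" "X = set_uprod v" by auto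
      then show "X \<in> {X. X \<subseteq> UNIV - {r} \<and> card X = 2}"
        by (cases v) (auto simp: edges_def)
    next
      fix X assume X: "X \<in> {X. X \<subseteq> UNIV - {r} \<and> card X = 2}"
      then obtain i j where "X = {i, j}" "i \<noteq> j" by (auto simp: card_2_iff)
      with X show "X \<in> set_uprod ` edges r"
        by (auto intro!: image_eqI[of _ _ "Upair i j"] simp: edges_def)
    qed
  qed
  then have "card (edges r) = card {X. X \<subseteq> UNIV - {r} \<and> card X = 2}"
    by (rule bij_betw_same_card)
  then show ?thesis
    by (simp add: n_subsets card_Diff_singleton)
qed

section \<open>Signs\<close>

text \<open>Multiplying \<open>s\<close> by a character of the degree lattice makes it trivial off \<open>edges r\<close>;
  \<open>flip_exp\<close> is the exponent of \<open>-1\<close> in the resulting normalised sign.\<close>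

definition flip_exp :: "'n::finite \<Rightarrow> ('n uprod \<Rightarrow> bool) \<Rightarrow> 'n uprod \<Rightarrow> nat" where
  "flip_exp r s v = of_bool (s v) + (\<Sum>j\<in>UNIV. of_bool (s (Upair r j)) * pmult j v) + of_bool (s (Upair r r))"

definition flips :: "'n::finite \<Rightarrow> ('n uprod \<Rightarrow> bool) \<Rightarrow> 'n uprod set" where
  "flips r s = {v \<in> edges r. odd (flip_exp r s v)}"

text \<open>The factor between \<open>msign s\<close> and the normalised sign. It depends on
  \<open>b\<close> alone because half the sum of \<open>b\<close> is the total degree of every
  monomial in the fiber.\<close>

definition fiber_sign :: "'n::finite \<Rightarrow> ('n uprod \<Rightarrow> bool) \<Rightarrow> ('n \<Rightarrow> nat) \<Rightarrow> 'k::comm_ring_1" where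
  "fiber_sign r s b = (- 1) ^ ((\<Sum>j\<in>UNIV. of_bool (s (Upair r j)) * b j)
     + of_bool (s (Upair r r)) * ((\<Sum>j\<in>UNIV. b j) div 2))"

lemma fiber_sign_sq [simp]: "fiber_sign r s b * fiber_sign r s b = 1"
  by (simp add: fiber_sign_def flip: power_mult_distrib)

lemma flip_exp_Upair: "flip_exp r s (Upair j k) =
    of_bool (s (Upair j k)) + of_bool (s (Upair r j)) + of_bool (s (Upair r k)) + of_bool (s (Upair r r))"
  by (simp add: flip_exp_def pmult_Upair distrib_left sum.distrib)

text \<open>Off \<open>edges r\<close> the four summands of \<open>flip_exp_Upair\<close> cancel in
  pairs modulo 2; for loops this uses the constant sign on the diagonal.\<close>

lemma even_flip_exp:
  assumes "\<And>j. s (Upair j j) = s (Upair r r)" and "v \<notin> edges r"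
  shows "even (flip_exp r s v)"
proof -
  obtain j k where v: "v = Upair j k" by (cases v) auto
  consider "j = k" | "j = r" | "k = r"
    using assms(2) by (auto simp: edges_def v)
  then show ?thesis
  proof cases
    case 1
    with assms(1)[of k] show ?thesis by (simp add: v flip_exp_Upair)
  next
    case 2
    then show ?thesis by (simp add: v flip_exp_Upair)
  next
    case 3
    moreover have "Upair j r = Upair r j" by simp
    ultimately show ?thesis by (simp only: v flip_exp_Upair) simp
  qed
qed

text \<open>Summing \<open>flip_exp\<close> over the variables of \<open>u\<close> gives the
  exponent of \<open>msign s u\<close> plus that of \<open>fiber_sign\<close>. Modulo 2 only
  variables in \<open>flips r s\<close> with odd exponent survive.\<close>

lemma msign_eq_walsh:
  fixes u :: "'n::finite mon" and r :: 'n
  assumes "\<And>j. s (Upair j j) = s (Upair r r)"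
  shows "msign s u = fiber_sign r s (Vdeg u) * (walsh (flips r s) (oddedges r u) :: 'k::comm_ring_1)"
proof -
  let ?u = "Poly_Mapping.lookup u"
  have "(\<Sum>v\<in>UNIV. flip_exp r s v * ?u v) = (\<Sum>v\<in>UNIV. of_bool (s v) * ?u v)
      + (\<Sum>v\<in>UNIV. \<Sum>j\<in>UNIV. of_bool (s (Upair r j)) * (?u v * pmult j v))
      + of_bool (s (Upair r r)) * tdeg u"
    unfolding flip_exp_def distrib_right sum.distrib sum_distrib_right tdeg_UNIV sum_distrib_left
    by (simp only: mult_ac)
  also have "(\<Sum>v\<in>UNIV. \<Sum>j\<in>UNIV. of_bool (s (Upair r j)) * (?u v * pmult j v))
      = (\<Sum>j\<in>UNIV. of_bool (s (Upair r j)) * Vdeg u j)"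
    by (subst sum.swap) (simp add: Vdeg_UNIV flip: sum_distrib_left)
  finally have "(- 1) ^ (\<Sum>v\<in>UNIV. flip_exp r s v * ?u v) =
      (- 1) ^ (\<Sum>v\<in>UNIV. of_bool (s v) * ?u v) * (fiber_sign r s (Vdeg u) :: 'k)"
    by (simp add: fiber_sign_def sum_Vdeg power_add mult.assoc)
  also have "(- 1) ^ (\<Sum>v\<in>UNIV. of_bool (s v) * ?u v) = (msign s u :: 'k)"
  proof -
    have "(- 1) ^ (of_bool (s v) * ?u v) = (sgn_of (s v) ^ ?u v :: 'k)" for v
      by (cases "s v") (simp_all add: sgn_of_def)
    then show ?thesis by (simp only: power_sum msign_def)
  qed
  finally have "msign s u = fiber_sign r s (Vdeg u) * ((- 1) ^ (\<Sum>v\<in>UNIV. flip_exp r s v * ?u v) :: 'k)"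
    by (simp add: mult.left_commute)
  also have "((- 1) ^ (\<Sum>v\<in>UNIV. flip_exp r s v * ?u v) :: 'k) = (\<Prod>v\<in>UNIV. (- 1) ^ (flip_exp r s v * ?u v))"
    by (rule power_sum)
  also have "\<dots> = walsh (flips r s) (oddedges r u)"
    unfolding walsh_def
  proof (rule prod.mono_neutral_cong_right)
    have "even (flip_exp r s v)" if "v \<notin> flips r s" for v
      using even_flip_exp[of s r v, OF assms] that by (auto simp: flips_def)
    then show "\<forall>v\<in>UNIV - flips r s. (- 1) ^ (flip_exp r s v * ?u v) = (1 :: 'k)"
      by simp
  qed (auto simp: flips_def oddedges_def sgn_of_def)
  finally show ?thesis .
qed

lemma fibsum_eq_walsh:
  fixes f :: "('n::finite, 'k::comm_ring_1) mpoly" and r :: 'n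
  assumes "\<And>j. s (Upair j j) = s (Upair r r)"
  shows "fibsum s b f = fiber_sign r s b *
    wsum (\<lambda>m. of_bool (Vdeg m = b) * walsh (flips r s) (oddedges r m)) f"
  unfolding wsum_weight_cmult[symmetric] fibsum_def msign_eq_walsh[of s r, OF assms]
  by (rule arg_cong[of _ _ "\<lambda>h. wsum h f"]) auto

section \<open>Fibers\<close>

text \<open>Only x_jj, x_rj and the edges avoiding \<open>r\<close> can meet \<open>j\<close>.
  Modulo 2, the degree and the odd edges thus determine the exponent of x_rj.\<close>

lemma Vdeg_split:
  fixes u :: "'n::finite mon"
  assumes "j \<noteq> r"
  shows "Vdeg u j = 2 * Poly_Mapping.lookup u (Upair j j) + Poly_Mapping.lookup u (Upair r j) +
    (\<Sum>v\<in>edges r. Poly_Mapping.lookup u v * pmult j v)"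
proof -
  have notin: "Upair j j \<notin> insert (Upair r j) (edges r)" "Upair r j \<notin> edges r"
    using assms by (auto simp: edges_def)
  have "Vdeg u j = (\<Sum>v\<in>insert (Upair j j) (insert (Upair r j) (edges r)). Poly_Mapping.lookup u v * pmult j v)"
    unfolding Vdeg_UNIV
  proof (rule sum.mono_neutral_right)
    show "\<forall>v\<in>UNIV - insert (Upair j j) (insert (Upair r j) (edges r)). Poly_Mapping.lookup u v * pmult j v = 0"
    proof
      fix v assume v: "v \<in> UNIV - insert (Upair j j) (insert (Upair r j) (edges r))"
      then show "Poly_Mapping.lookup u v * pmult j v = 0"
        using assms by (cases v) (auto simp: edges_def pmult_Upair)
    qed
  qed auto
  also have "\<dots> = 2 * Poly_Mapping.lookup u (Upair j j) + Poly_Mapping.lookup u (Upair r j) +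
    (\<Sum>v\<in>edges r. Poly_Mapping.lookup u v * pmult j v)"
    using notin assms by (simp add: pmult_Upair)
  finally show ?thesis .
qed

section \<open>The lattice \<open>L'\<^sub>n\<close> and its classes in a fiber\<close>

lemma Lprime_zero: "(\<lambda>_. 0) \<in> Lprime"
  unfolding Lprime_def by (auto intro!: exI[of _ "\<lambda>_. 0"])

lemma Lprime_add: "x \<in> Lprime \<Longrightarrow> y \<in> Lprime \<Longrightarrow> (\<lambda>v. x v + y v) \<in> Lprime"
proof -
  assume "x \<in> Lprime" "y \<in> Lprime"
  then obtain c d where "x = (\<lambda>v. \<Sum>ij\<in>UNIV. c ij * brk (fst ij) (snd ij) v)"
    "y = (\<lambda>v. \<Sum>ij\<in>UNIV. d ij * brk (fst ij) (snd ij) v)"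
    unfolding Lprime_def by blast
  then have "(\<lambda>v. x v + y v) = (\<lambda>v. \<Sum>ij\<in>UNIV. (c ij + d ij) * brk (fst ij) (snd ij) v)"
    by (simp add: distrib_right sum.distrib)
  then show ?thesis
    unfolding Lprime_def by (intro CollectI exI[of _ "\<lambda>ij. c ij + d ij"]) simp
qed

lemma Lprime_brk: "(\<lambda>v. c * brk i j v) \<in> Lprime"
proof -
  have "(if ij = (i, j) then c else 0) * brk (fst ij) (snd ij) v = (if ij = (i, j) then c * brk i j v else 0)" for ij v
    by auto
  then have "(\<lambda>v. c * brk i j v) = (\<lambda>v. \<Sum>ij\<in>UNIV. (if ij = (i, j) then c else 0) * brk (fst ij) (snd ij) v)"
    by (intro ext) (simp only: sum.delta[OF finite] UNIV_I if_True)
  then show ?thesis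
    unfolding Lprime_def by (intro CollectI exI[of _ "\<lambda>ij. if ij = (i, j) then c else 0"] conjI TrueI)
qed

lemma Lprime_sum:
  "(\<And>i. i \<in> X \<Longrightarrow> f i \<in> Lprime) \<Longrightarrow> (\<lambda>v. \<Sum>i\<in>X. f i v) \<in> Lprime"
  by (induction X rule: infinite_finite_induct) (auto intro: Lprime_zero Lprime_add)

text \<open>Off the diagonal a generator has only the entries 0 and -2.\<close>

lemma Lprime_even:
  assumes "x \<in> Lprime" "proper_uprod v"
  shows "even (x v)"
proof -
  have "even (brk i j v)" for i j
    using assms(2) by (cases v) (auto simp: brk_def)
  then show ?thesis
    using assms(1) unfolding Lprime_def by (auto intro!: dvd_sum)
qed

lemma sum_brk_pmult: "(\<Sum>v\<in>UNIV. brk i j v * int (pmult (k :: 'n::finite) v)) = 0"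
proof -
  have "brk i j v * int (pmult k v) = (if v = Upair i i then int (pmult k (Upair i i)) else 0)
      + (if v = Upair j j then int (pmult k (Upair j j)) else 0)
      - 2 * (if v = Upair i j then int (pmult k (Upair i j)) else 0)" for v
    by (auto simp: brk_def)
  then show ?thesis
    by (simp add: sum.distrib sum_subtractf pmult_Upair flip: sum_distrib_left)
qed

text \<open>The degree equations recover the diagonal entries from the off-diagonal ones.\<close>

lemma eq_if_eq_proper:
  fixes x y :: "'n::finite uprod \<Rightarrow> int"
  assumes "\<And>v. proper_uprod v \<Longrightarrow> x v = y v"
    and "\<And>k. (\<Sum>v\<in>UNIV. x v * int (pmult k v)) = (\<Sum>v\<in>UNIV. y v * int (pmult k v))"
  shows "x = y"
proof
  fix v
  show "x v = y v"
  proof (cases "proper_uprod v")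
    case False
    then obtain j where v: "v = Upair j j" by (cases v) auto
    have "(\<Sum>w\<in>UNIV - {v}. x w * int (pmult j w)) = (\<Sum>w\<in>UNIV - {v}. y w * int (pmult j w))"
    proof (rule sum.cong)
      fix w assume "w \<in> UNIV - {v}"
      then show "x w * int (pmult j w) = y w * int (pmult j w)"
        using assms(1)[of w] by (cases w) (auto simp: v pmult_Upair)
    qed simp
    with assms(2)[of j] show ?thesis
      by (simp add: sum.remove[of UNIV v] v pmult_Upair)
  qed (rule assms)
qed

text \<open>Lattice vectors are even off the diagonal, which gives one direction. Conversely, a
  difference that is even on \<open>edges r\<close> is even on the edges at \<open>r\<close> by the
  degree equations. Generators then match it off the diagonal, and equal degrees force agreement on
  the diagonal.\<close>

lemma lat_equiv_iff_oddedges: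
  fixes u w :: "'n::finite mon"
  assumes deg: "Vdeg u = Vdeg w"
  shows "lat_equiv u w \<longleftrightarrow> oddedges r u = oddedges r w"
proof
  assume "lat_equiv u w"
  then have "even (int (Poly_Mapping.lookup u v) - int (Poly_Mapping.lookup w v))" if "proper_uprod v" for v
    using Lprime_even[OF _ that] unfolding lat_equiv_def by blast
  then show "oddedges r u = oddedges r w"
    by (auto simp: oddedges_def edges_def)
next
  assume eq: "oddedges r u = oddedges r w"
  let ?d = "\<lambda>v. int (Poly_Mapping.lookup u v) - int (Poly_Mapping.lookup w v)"
  have even_edges: "even (?d v)" if "v \<in> edges r" for v
    using eq that by (auto simp: oddedges_def set_eq_iff)
  have even_r: "even (?d (Upair r j))" if "j \<noteq> r" for j
  proof -
    have "0 = int (Vdeg u j) - int (Vdeg w j)" by (simp add: deg)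
    also have "\<dots> = 2 * ?d (Upair j j) + ?d (Upair r j) + (\<Sum>v\<in>edges r. ?d v * int (pmult j v))"
      unfolding Vdeg_split[OF that] by (simp add: sum_subtractf left_diff_distrib)
    finally have "0 = 2 * ?d (Upair j j) + ?d (Upair r j) + (\<Sum>v\<in>edges r. ?d v * int (pmult j v))" .
    moreover have "even (\<Sum>v\<in>edges r. ?d v * int (pmult j v))"
      by (rule dvd_sum) (use even_edges in auto)
    ultimately show ?thesis by presburger
  qed
  have even_d: "even (?d v)" if "proper_uprod v" for v
  proof (cases "v \<in> edges r")
    case False
    obtain j k where v: "v = Upair j k" by (cases v) auto
    with False that have "v = Upair r j \<and> j \<noteq> r \<or> v = Upair r k \<and> k \<noteq> r"
      by (auto simp: edges_def)
    then show ?thesis using even_r by metis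
  qed (rule even_edges)
  \<comment> \<open>\<open>brk\<close> takes an ordered pair, so each edge gets a chosen ordering of
    its ends.\<close>
  define a where "a v = (SOME ij. Upair (fst ij) (snd ij) = v)" for v :: "'n uprod"
  have a: "Upair (fst (a v)) (snd (a v)) = v" for v
  proof -
    have "\<exists>ij. Upair (fst ij) (snd ij) = v" by (cases v) auto
    then show ?thesis unfolding a_def by (rule someI_ex)
  qed
  \<comment> \<open>The generator belonging to \<open>e\<close> has entry -2 at \<open>e\<close> and
    0 at all other edges, hence minus half the difference as coefficient.\<close>
  define x where "x v = (\<Sum>e\<in>Collect proper_uprod. - (?d e div 2) * brk (fst (a e)) (snd (a e)) v)" for v
  have "x \<in> Lprime"
    unfolding x_def by (rule Lprime_sum) (rule Lprime_brk)
  moreover have "x = ?d"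
  proof (rule eq_if_eq_proper)
    fix v :: "'n uprod" assume v: "proper_uprod v"
    have "brk (fst (a e)) (snd (a e)) v = (if e = v then - 2 else 0)" for e
    proof -
      have "v \<noteq> Upair k k" for k using v by auto
      then show ?thesis by (auto simp: brk_def a)
    qed
    then have "- (?d e div 2) * brk (fst (a e)) (snd (a e)) v = (if e = v then ?d v else 0)" for e
      using dvd_div_mult_self[OF even_d[OF v]] by simp
    then show "x v = ?d v"
      using v by (simp only: x_def sum.delta[OF finite] mem_Collect_eq if_True)
  next
    fix k
    have "(\<Sum>v\<in>UNIV. x v * int (pmult k v)) =
       (\<Sum>e\<in>Collect proper_uprod. - (?d e div 2) * (\<Sum>v\<in>UNIV. brk (fst (a e)) (snd (a e)) v * int (pmult k v)))"
      unfolding x_def sum_distrib_right sum_distrib_left by (subst sum.swap) (simp add: mult.assoc)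
    also have "\<dots> = int (Vdeg u k) - int (Vdeg w k)" by (simp add: sum_brk_pmult deg)
    also have "\<dots> = (\<Sum>v\<in>UNIV. ?d v * int (pmult k v))"
      by (simp add: Vdeg_UNIV sum_subtractf left_diff_distrib)
    finally show "(\<Sum>v\<in>UNIV. x v * int (pmult k v)) = (\<Sum>v\<in>UNIV. ?d v * int (pmult k v))" .
  qed
  ultimately show "lat_equiv u w" unfolding lat_equiv_def by simp
qed

section \<open>Which degrees and odd edge sets are realised by monomials\<close>

lemma ex_mon_Vdeg:
  fixes b :: "'n::finite \<Rightarrow> nat"
  assumes "even (\<Sum>k\<in>UNIV. b k)"
  shows "\<exists>u. Vdeg u = b"
  using assms
proof (induction "\<Sum>k\<in>UNIV. b k" arbitrary: b rule: less_induct)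
  case less
  \<comment> \<open>Removing a variable that fits below \<open>b\<close> lowers the sum by 2. Such a
    variable is a loop at an entry of at least 2, or else an edge joining two nonzero entries; a
    single entry 1 is excluded by parity.\<close>
  have step: "\<exists>u. Vdeg u = b" if le: "\<And>k. pmult k v \<le> b k" for v
  proof -
    let ?c = "\<lambda>k. b k - pmult k v"
    have "(\<Sum>k\<in>UNIV. ?c k) + 2 = (\<Sum>k\<in>UNIV. b k)"
      using le by (simp flip: sum_pmult[of v] sum.distrib)
    with less obtain u where "Vdeg u = ?c" by (metis even_add even_numeral less_add_same_cancel1 zero_less_numeral)
    then have "Vdeg (u + Poly_Mapping.single v 1) = b"
      using le by (auto simp: fun_eq_iff Vdeg_add)
    then show ?thesis ..
  qed
  show ?case
  proof (cases "b = (\<lambda>_. 0)")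
    case True
    then show ?thesis by (intro exI[of _ 0]) simp
  next
    case False
    then obtain j where j: "b j \<noteq> 0" by auto
    show ?thesis
    proof (cases "b j \<ge> 2")
      case True
      then show ?thesis by (intro step[of "Upair j j"]) (auto simp: pmult_Upair)
    next
      case j1: False
      have "\<exists>k. k \<noteq> j \<and> b k \<noteq> 0"
      proof (rule ccontr)
        assume "\<nexists>k. k \<noteq> j \<and> b k \<noteq> 0"
        then have "(\<Sum>k\<in>UNIV. b k) = (\<Sum>k\<in>{j}. b k)"
          by (intro sum.mono_neutral_right) auto
        with less(2) have "even (b j)" by simp
        with j j1 show False by presburger
      qed
      then obtain k where "k \<noteq> j" "b k \<noteq> 0" by blast
      then show ?thesis using j by (intro step[of "Upair j k"]) (auto simp: pmult_Upair of_bool_def)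
    qed
  qed
qed

lemma Vdeg_le_squarefree:
  fixes u :: "'n::finite mon"
  assumes "\<And>v. Poly_Mapping.lookup u v \<le> of_bool (proper_uprod v)"
  shows "Vdeg u j \<le> CARD('n) - 1"
proof -
  have "Vdeg u j = (\<Sum>v\<in>Upair j ` (UNIV - {j}). Poly_Mapping.lookup u v * pmult j v)"
    unfolding Vdeg_UNIV
  proof (rule sum.mono_neutral_right)
    show "\<forall>v\<in>UNIV - Upair j ` (UNIV - {j}). Poly_Mapping.lookup u v * pmult j v = 0"
    proof
      fix v assume v: "v \<in> UNIV - Upair j ` (UNIV - {j})"
      obtain k l where kl: "v = Upair k l" by (cases v) auto
      with v have "j \<notin> {k, l} \<or> k = l" by auto
      then show "Poly_Mapping.lookup u v * pmult j v = 0"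
        using assms[of v] by (auto simp: kl pmult_Upair)
    qed
  qed auto
  also have "\<dots> \<le> (\<Sum>v\<in>Upair j ` (UNIV - {j}). 1)"
  proof (rule sum_mono)
    fix v assume "v \<in> Upair j ` (UNIV - {j})"
    then have "pmult j v = 1" by (auto simp: pmult_Upair)
    then show "Poly_Mapping.lookup u v * pmult j v \<le> 1"
      using assms[of v] by (cases "proper_uprod v") auto
  qed
  also have "\<dots> = card (Upair j ` (UNIV - {j}))"
    by simp
  also have "\<dots> \<le> card (UNIV - {j})"
    by (rule card_image_le) simp
  finally show ?thesis by (simp add: card_Diff_singleton)
qed

lemma lookup_Abs_finite [simp]:
  "Poly_Mapping.lookup (Abs_poly_mapping f) = (f :: 'a::finite \<Rightarrow> 'b::zero)"
  by (rule lookup_Abs_poly_mapping) simp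

text \<open>Add to the graph \<open>H\<close> those edges at \<open>r\<close> that correct the
  parity at every other vertex; the parity at \<open>r\<close> follows from the even total. The
  simple graph obtained has degrees at most \<open>b\<close>, and loops fill the even
  remainder.\<close>

lemma ex_mon_oddedges:
  fixes b :: "'n::finite \<Rightarrow> nat"
  assumes n: "CARD('n) \<ge> 2" and even: "even (\<Sum>k\<in>UNIV. b k)"
    and b: "\<And>k. CARD('n) - 2 \<le> b k" and H: "H \<subseteq> edges r"
  shows "\<exists>u. Vdeg u = b \<and> oddedges r u = H"
proof -
  define S where "S = H \<union> Upair r ` {j. j \<noteq> r \<and> odd (b j + (\<Sum>v\<in>H. pmult j v))}"
  define u0 :: "'n mon" where "u0 = Abs_poly_mapping (\<lambda>v. of_bool (v \<in> S))"
  have u0: "Poly_Mapping.lookup u0 v = of_bool (v \<in> S)" for v by (simp add: u0_def)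
  have S: "proper_uprod v" if "v \<in> S" for v
    using that H by (auto simp: S_def edges_def)
  have S_edges: "v \<in> S \<longleftrightarrow> v \<in> H" if "v \<in> edges r" for v
    using that by (auto simp: S_def edges_def)
  have par_ne: "even (b j + Vdeg u0 j)" if "j \<noteq> r" for j
  proof -
    have "(\<Sum>v\<in>edges r. Poly_Mapping.lookup u0 v * pmult j v) = (\<Sum>v\<in>H. pmult j v)"
      using H S_edges by (intro sum.mono_neutral_cong_right) (auto simp: u0)
    moreover have "Upair j j \<notin> S" using S by fastforce
    moreover have "Upair r j \<in> S \<longleftrightarrow> odd (b j + (\<Sum>v\<in>H. pmult j v))"
      using that H by (auto simp: S_def edges_def)
    ultimately show ?thesis by (simp add: Vdeg_split[OF that] u0)
  qed
  have par: "even (b j + Vdeg u0 j)" for j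
  proof (cases "j = r")
    case True
    have "even (\<Sum>k\<in>UNIV. b k + Vdeg u0 k)"
      using even by (simp add: sum.distrib sum_Vdeg)
    moreover have "even (\<Sum>k\<in>UNIV - {r}. b k + Vdeg u0 k)"
      by (rule dvd_sum) (use par_ne in auto)
    ultimately show ?thesis
      by (simp add: sum.remove[of UNIV r] True)
  qed (rule par_ne)
  have le: "Vdeg u0 j \<le> b j" for j
  proof -
    have "Vdeg u0 j \<le> CARD('n) - 1"
      by (rule Vdeg_le_squarefree) (use S in \<open>auto simp: u0\<close>)
    \<comment> \<open>If \<open>b j\<close> is \<open>CARD('n) - 2\<close>, parity rules out the
      degree \<open>CARD('n) - 1\<close>.\<close>
    then show ?thesis using b[of j] par[of j] n by presburger
  qed
  define w :: "'n mon" where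
    "w = Abs_poly_mapping (\<lambda>v. \<Sum>k\<in>UNIV. of_bool (v = Upair k k) * ((b k - Vdeg u0 k) div 2))"
  have w: "Poly_Mapping.lookup w v = 0" if "proper_uprod v" for v
    using that by (auto simp: w_def)
  have "Vdeg w j = b j - Vdeg u0 j" for j
  proof -
    have "Poly_Mapping.lookup w v * pmult j v =
      (if v = Upair j j then b j - Vdeg u0 j else 0)" for v
    proof (cases "proper_uprod v")
      case False
      then obtain k where v: "v = Upair k k" by (cases v) auto
      have "(\<Sum>l\<in>UNIV. of_bool (v = Upair l l) * ((b l - Vdeg u0 l) div 2)) =
        (\<Sum>l\<in>UNIV. if k = l then (b k - Vdeg u0 k) div 2 else 0)"
        by (rule sum.cong) (auto simp: v)
      then have "Poly_Mapping.lookup w v = (b k - Vdeg u0 k) div 2"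
        by (simp add: w_def)
      moreover have "even (b k - Vdeg u0 k)" using par[of k] by simp
      then have "(b k - Vdeg u0 k) div 2 * 2 = b k - Vdeg u0 k" by (rule dvd_div_mult_self)
      ultimately show ?thesis by (auto simp: v pmult_def)
    next
      case True
      then show ?thesis using w by auto
    qed
    then show ?thesis by (simp add: Vdeg_UNIV)
  qed
  then have "Vdeg (u0 + w) = b" using le by (simp add: fun_eq_iff Vdeg_add)
  moreover have "oddedges r (u0 + w) = H"
    using S_edges w H by (auto simp: oddedges_def lookup_add u0 edges_def)
  ultimately show ?thesis by blast
qed

text \<open>The witness is the star at \<open>v\<close> inside the complement of \<open>r\<close>.
  It has \<open>CARD('n) - 2\<close> edges, and odd exponents on all of them already push the degree
  at \<open>v\<close> above \<open>b v\<close>.\<close>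

lemma ex_missing_oddedges:
  fixes b :: "'n::finite \<Rightarrow> nat"
  assumes "b v < CARD('n) - 2" and "r \<noteq> v"
  shows "\<exists>H\<subseteq>edges r. \<forall>u. Vdeg u = b \<longrightarrow> oddedges r u \<noteq> H"
proof (intro exI conjI allI impI notI)
  let ?H = "Upair v ` (UNIV - {v, r})"
  show "?H \<subseteq> edges r" using assms by (auto simp: edges_def)
  fix u assume "Vdeg u = b" and H: "oddedges r u = ?H"
  have "card ?H = CARD('n) - 2"
    using assms(2) by (subst card_image) (auto simp: inj_on_def card_Diff_subset)
  then have "CARD('n) - 2 = (\<Sum>e\<in>?H. 1)" by simp
  also have "\<dots> \<le> (\<Sum>e\<in>?H. Poly_Mapping.lookup u e * pmult v e)"
  proof (rule sum_mono)
    fix e assume e: "e \<in> ?H"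
    then have "odd (Poly_Mapping.lookup u e)" using H by (auto simp: oddedges_def)
    moreover have "pmult v e = 1" using e by (auto simp: pmult_Upair)
    ultimately show "1 \<le> Poly_Mapping.lookup u e * pmult v e"
      by (simp add: Suc_le_eq odd_pos)
  qed
  also have "\<dots> \<le> Vdeg u v"
    unfolding Vdeg_UNIV by (rule sum_mono2) auto
  finally show False using \<open>Vdeg u = b\<close> assms(1) by simp
qed

section \<open>Omitting one component\<close>

lemma fibsum_sum: "fibsum s b (\<Sum>x\<in>X. f x) = (\<Sum>x\<in>X. fibsum s b (f x))"
  by (simp add: fibsum_def wsum_sum)

lemma fibsum_diff: "fibsum s b (f - g) = fibsum s b f - fibsum s b g"
  by (simp add: fibsum_def wsum_diff)

lemma fibsum_scale: "fibsum s b (Poly_Mapping.single 0 c * f) = c * fibsum s b f"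
  unfolding fibsum_def wsum_mult wsum_single by (simp add: mult.commute[of c])

text \<open>The square in a principal minor has sign 1, so membership of the minor in the component
  forces the product of the two diagonal signs to be 1; here -1 and 1 are distinct.\<close>

lemma diagonal_sign_constant:
  fixes s :: "'n::finite uprod \<Rightarrow> bool"
  assumes char: "(2 :: 'k::comm_ring_1) \<noteq> 0"
    and prime: "prime_ideal (I_n :: ('n, 'k) mpoly set)"
    and J: "(J_n :: ('n, 'k) mpoly set) \<subseteq> twist s ` I_n"
  shows "s (Upair i i) = s (Upair j j)"
proof (cases "i = j")
  case False
  let ?m = "Poly_Mapping.single (Upair i i) 1 + Poly_Mapping.single (Upair j j) 1 :: 'n mon"
  let ?f = "xv i i * xv j j - (xv i j)^2 :: ('n, 'k) mpoly"
  have f: "?f = Poly_Mapping.single ?m 1 - Poly_Mapping.single (Poly_Mapping.single (Upair i j) 2) 1"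
    by (simp add: xv_mult_xv xv_power)
  have "?f \<in> J_n"
    unfolding J_n_def by (rule subsetD[OF ideal_span_superset]) blast
  then have "fibsum s (Vdeg ?m) ?f = 0"
    using J twist_I_n_iff[OF prime] by blast
  moreover have "Vdeg (Poly_Mapping.single (Upair i j) 2) = Vdeg ?m"
    by (rule ext) (simp add: Vdeg_add pmult_Upair)
  ultimately have "sgn_of (s (Upair i i)) * sgn_of (s (Upair j j)) - (1 :: 'k) = 0"
    unfolding f fibsum_def wsum_diff wsum_single by (simp add: msign_add power2_eq_square)
  then show ?thesis
    using char by (auto simp: sgn_of_def split: if_splits)
qed simp

text \<open>The fiber sums of the two twists then differ only by signs, so they vanish together.
  Hence distinct components have distinct flips.\<close>

lemma twist_I_n_eq_if_flips_eq:
  fixes r :: "'n::finite"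
  assumes prime: "prime_ideal (I_n :: ('n, 'k::comm_ring_1) mpoly set)"
    and s: "\<And>j. s (Upair j j) = s (Upair r r)" and t: "\<And>j. t (Upair j j) = t (Upair r r)"
    and eq: "flips r s = flips r t"
  shows "twist s ` (I_n :: ('n, 'k) mpoly set) = twist t ` I_n"
proof -
  have zero: "fiber_sign r s b * x = 0 \<longleftrightarrow> x = 0" for s b and x :: 'k
    by (metis fiber_sign_sq mult.assoc mult_1 mult_zero_right)
  show ?thesis
    unfolding set_eq_iff twist_I_n_iff[OF prime] fibsum_eq_walsh[of s r, OF s] fibsum_eq_walsh[of t r, OF t] zero eq
    by simp
qed

section \<open>Generating functions of fibers\<close>

lemma is_genfunE:
  assumes "is_genfun F p"
  obtains A where "A \<subseteq> F" "finite A" "\<forall>u\<in>F. \<exists>!a\<in>A. lat_equiv u a"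
    "p = (\<Sum>a\<in>A. Poly_Mapping.single a 1)"
  using assms unfolding is_genfun_def by (elim exE conjE)

text \<open>Equivalence in a fiber is equality of odd edges, so representatives have distinct edge
  sets; \<open>ex_mon_oddedges\<close> shows that every edge set occurs.\<close>

lemma is_genfun_oddedges:
  fixes p :: "('n::finite, 'k::comm_ring_1) mpoly"
  assumes n: "CARD('n) \<ge> 2" and even: "even (\<Sum>k\<in>UNIV. b k)"
    and b: "\<And>k. CARD('n) - 2 \<le> b k" and p: "is_genfun (fiber b) p"
  obtains A where "A \<subseteq> fiber b" "finite A" "p = (\<Sum>a\<in>A. Poly_Mapping.single a 1)"
    "bij_betw (oddedges r) A (Pow (edges r))"
proof -
  from p obtain A where A: "A \<subseteq> fiber b" "finite A" "p = (\<Sum>a\<in>A. Poly_Mapping.single a 1)"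
    and ex: "\<forall>u\<in>fiber b. \<exists>!a\<in>A. lat_equiv u a"
    by (rule is_genfunE)
  have equiv: "lat_equiv u w \<longleftrightarrow> oddedges r u = oddedges r w" if "u \<in> fiber b" "w \<in> fiber b" for u w
    using that by (intro lat_equiv_iff_oddedges) (simp add: fiber_def)
  have "bij_betw (oddedges r) A (Pow (edges r))"
  proof (rule bij_betw_imageI)
    show "inj_on (oddedges r) A"
    proof (rule inj_onI)
      fix u w assume uw: "u \<in> A" "w \<in> A" "oddedges r u = oddedges r w"
      then have "u \<in> fiber b" "w \<in> fiber b" using A(1) by auto
      then have "lat_equiv u u" "lat_equiv u w" using uw(3) by (simp_all add: equiv)
      then show "u = w" using bspec[OF ex \<open>u \<in> fiber b\<close>] uw(1,2) by auto
    qed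
    show "oddedges r ` A = Pow (edges r)"
    proof
      show "oddedges r ` A \<subseteq> Pow (edges r)" by (auto simp: oddedges_def)
      show "Pow (edges r) \<subseteq> oddedges r ` A"
      proof
        fix H assume "H \<in> Pow (edges r)"
        then obtain u where u: "u \<in> fiber b" "oddedges r u = H"
          using ex_mon_oddedges[OF n even b, of H r] by (auto simp: fiber_def)
        obtain a where "a \<in> A" "lat_equiv u a" using bspec[OF ex u(1)] by auto
        then show "H \<in> oddedges r ` A" using equiv[of u a] u A(1) by auto
      qed
    qed
  qed
  with A that show thesis by blast
qed

text \<open>Up to sign, the twisted generating function tabulates the character of \<open>t\<close>
  over all edge sets, so its fiber sum under \<open>s\<close> is an inner product of two characters.
  The monomial \<open>d\<close> shifts the degree away from \<open>b\<close>.\<close>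

lemma fibsum_genfun:
  fixes p :: "('n::finite, 'k::comm_ring_1) mpoly" and r :: 'n
  assumes n: "CARD('n) \<ge> 2" and even: "even (\<Sum>k\<in>UNIV. b k)"
    and b: "\<And>k. CARD('n) - 2 \<le> b k" and p: "is_genfun (fiber b) p"
    and s: "\<And>j. s (Upair j j) = s (Upair r r)" and t: "\<And>j. t (Upair j j) = t (Upair r r)"
  shows "fibsum s c (Poly_Mapping.single d 1 * twist t p) = of_bool (c = (\<lambda>k. Vdeg d k + b k)) *
    (msign s d * fiber_sign r s b * fiber_sign r t b * (if flips r s = flips r t then 2 ^ card (edges r) else 0))"
proof -
  obtain A where A: "A \<subseteq> fiber b" "finite A" "p = (\<Sum>a\<in>A. Poly_Mapping.single a 1)"
    and bij: "bij_betw (oddedges r) A (Pow (edges r))"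
    using is_genfun_oddedges[OF n even b p, of r] by blast
  have Vdeg_a: "Vdeg a = b" if "a \<in> A" for a using that A(1) by (auto simp: fiber_def)
  let ?C = "of_bool (c = (\<lambda>k. Vdeg d k + b k)) * (msign s d * fiber_sign r s b * fiber_sign r t b) :: 'k"
  have "fibsum s c (Poly_Mapping.single d 1 * twist t p) =
      (\<Sum>a\<in>A. of_bool (Vdeg (d + a) = c) * msign s (d + a) * msign t a)"
    unfolding fibsum_def wsum_mult wsum_single wsum_twist A(3) wsum_sum by simp
  also have "\<dots> = (\<Sum>a\<in>A. ?C * (walsh (flips r s) (oddedges r a) * walsh (flips r t) (oddedges r a)))"
  proof (rule sum.cong)
    fix a assume a: "a \<in> A"
    have "Vdeg (d + a) = c \<longleftrightarrow> c = (\<lambda>k. Vdeg d k + b k)"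
      using Vdeg_a[OF a] by (auto simp: fun_eq_iff Vdeg_add)
    then show "of_bool (Vdeg (d + a) = c) * msign s (d + a) * msign t a =
        ?C * (walsh (flips r s) (oddedges r a) * walsh (flips r t) (oddedges r a))"
      by (simp add: msign_add msign_eq_walsh[of s r a, OF s] msign_eq_walsh[of t r a, OF t] Vdeg_a[OF a] mult_ac)
  qed simp
  also have "\<dots> = ?C * (\<Sum>H\<in>Pow (edges r). walsh (flips r s) H * walsh (flips r t) H)"
    unfolding sum_distrib_left[symmetric] sum.reindex_bij_betw[OF bij, symmetric] ..
  \<comment> \<open>Orthogonality is stated for sums over the first argument, so the arguments are
    swapped.\<close>
  also have "(\<Sum>H\<in>Pow (edges r). walsh (flips r s) H * walsh (flips r t) H) =
      (\<Sum>H\<in>Pow (edges r). walsh H (flips r s) * walsh H (flips r t) :: 'k)"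
    by (simp only: walsh_commute[OF finite finite, of "flips r _"])
  also have "\<dots> = (if flips r s = flips r t then 2 ^ card (edges r) else 0)"
    by (rule walsh_orthogonal) (auto simp: flips_def)
  finally show ?thesis by (simp add: mult.assoc)
qed

text \<open>By orthogonality, weighting the fiber sums with the characters evaluated at the missing \<open>H\<close>
  sums to zero, and every weight is \<open>\<plusminus>1\<close>.\<close>

lemma fibsum_zero_if_not_full:
  fixes f :: "('n::finite, 'k::comm_ring_1) mpoly" and s :: "'i \<Rightarrow> 'n uprod \<Rightarrow> bool"
  assumes b: "b v < CARD('n) - 2"
    and s: "\<And>i j k. i \<in> K \<Longrightarrow> s i (Upair j j) = s i (Upair k k)"
    and bij: "\<And>r. bij_betw (\<lambda>i. flips r (s i)) K (Pow (edges r))"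
    and zero: "\<And>i. i \<in> K - {l} \<Longrightarrow> fibsum (s i) b f = 0" and l: "l \<in> K"
  shows "fibsum (s l) b f = 0"
proof -
  \<comment> \<open>The missing star needs a base vertex other than \<open>v\<close>; this is why
    \<open>bij\<close> is assumed for every \<open>r\<close>.\<close>
  have "card (UNIV - {v}) > 0" using b by (simp add: card_Diff_singleton)
  then obtain r where r: "r \<noteq> v" by (metis Diff_iff card_gt_0_iff ex_in_conv singletonI)
  obtain H where H: "H \<subseteq> edges r" "\<And>u. Vdeg u = b \<Longrightarrow> oddedges r u \<noteq> H"
    using ex_missing_oddedges[of b v r] b r by metis
  let ?F = "\<lambda>i. flips r (s i)"
  define g :: "'i \<Rightarrow> 'k" where "g i = fiber_sign r (s i) b * walsh (?F i) H" for i
  have finK: "finite K" using bij_betw_finite[OF bij[of r]] by simp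
  have "(\<Sum>i\<in>K. g i * fibsum (s i) b f) =
    (\<Sum>i\<in>K. walsh (?F i) H * wsum (\<lambda>m. of_bool (Vdeg m = b) * walsh (?F i) (oddedges r m)) f)"
  proof (rule sum.cong)
    fix i assume "i \<in> K"
    then have eq: "fibsum (s i) b f = fiber_sign r (s i) b *
        wsum (\<lambda>m. of_bool (Vdeg m = b) * walsh (?F i) (oddedges r m)) f"
      by (intro fibsum_eq_walsh s)
    have sq: "fiber_sign r (s i) b * (fiber_sign r (s i) b * x) = x" for x :: 'k
      by (simp flip: mult.assoc)
    show "g i * fibsum (s i) b f =
        walsh (?F i) H * wsum (\<lambda>m. of_bool (Vdeg m = b) * walsh (?F i) (oddedges r m)) f"
      unfolding g_def eq mult.assoc mult.left_commute[of "walsh _ _" "fiber_sign _ _ _"] sq ..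
  qed simp
  also have "\<dots> = wsum (\<lambda>m. \<Sum>i\<in>K. walsh (?F i) H * (of_bool (Vdeg m = b) * walsh (?F i) (oddedges r m))) f"
    by (simp add: wsum_weight_sum wsum_weight_cmult)
  also have "(\<lambda>m. \<Sum>i\<in>K. walsh (?F i) H * (of_bool (Vdeg m = b) * walsh (?F i) (oddedges r m))) = (\<lambda>m. 0 :: 'k)"
  proof
    fix m
    have "(\<Sum>i\<in>K. walsh (?F i) H * walsh (?F i) (oddedges r m)) =
        (\<Sum>E\<in>Pow (edges r). walsh E H * walsh E (oddedges r m) :: 'k)"
      by (rule sum.reindex_bij_betw[OF bij])
    also have "\<dots> = (if H = oddedges r m then 2 ^ card (edges r) else 0)"
      using H(1) by (intro walsh_orthogonal) (auto simp: oddedges_def)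
    finally have "Vdeg m = b \<Longrightarrow> (\<Sum>i\<in>K. walsh (?F i) H * walsh (?F i) (oddedges r m)) = (0 :: 'k)"
      using H(2)[of m] by auto
    then show "(\<Sum>i\<in>K. walsh (?F i) H * (of_bool (Vdeg m = b) * walsh (?F i) (oddedges r m))) = (0 :: 'k)"
      by (cases "Vdeg m = b") simp_all
  qed
  finally have "(\<Sum>i\<in>K. g i * fibsum (s i) b f) = 0"
    by (simp add: wsum_def)
  then have "g l * fibsum (s l) b f = 0"
    using zero by (simp add: sum.remove[OF finK l])
  then have "(g l * g l) * fibsum (s l) b f = 0"
    by (simp add: mult.assoc)
  moreover have "g l * g l = 1"
  proof -
    have "g l * g l = (fiber_sign r (s l) b * fiber_sign r (s l) b) * (walsh (?F l) H * walsh (?F l) H)"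
      unfolding g_def by (simp only: mult_ac)
    then show ?thesis by simp
  qed
  ultimately show ?thesis by simp
qed

text \<open>Common form of both parities: \<open>Q\<close> indexes the generating functions, and
  \<open>cover\<close> says that their degrees lie below every realisable degree with all entries at
  least \<open>CARD('n) - 2\<close>. For \<open>f\<close> in all components but \<open>l\<close>,
  multiples of the generators remove the fiber sums at \<open>l\<close> degree by degree, leaving an
  element of \<open>J_n\<close>.\<close>

lemma INT_twist_I_n_eq_ideal_span:
  fixes s :: "'i \<Rightarrow> 'n::finite uprod \<Rightarrow> bool" and p :: "'q \<Rightarrow> ('n, 'k::field) mpoly"
  assumes n: "CARD('n) \<ge> 2" and char: "(2::'k) \<noteq> 0"
    and K: "finite K" "card K = 2 ^ ((CARD('n) - 1) choose 2)" and l: "l \<in> K"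
    and decomp: "(J_n :: ('n, 'k) mpoly set) = (\<Inter>i\<in>K. twist (s i) ` I_n)"
    and primes: "\<And>i. i \<in> K \<Longrightarrow> prime_ideal (twist (s i) ` (I_n :: ('n, 'k) mpoly set))"
    and distinct: "inj_on (\<lambda>i. twist (s i) ` (I_n :: ('n, 'k) mpoly set)) K"
    and genfun: "\<And>q. q \<in> Q \<Longrightarrow> is_genfun (fiber (b q)) (p q)"
    and even_b: "\<And>q. q \<in> Q \<Longrightarrow> even (\<Sum>k\<in>UNIV. b q k)"
    and ge_b: "\<And>q k. q \<in> Q \<Longrightarrow> CARD('n) - 2 \<le> b q k"
    and cover: "\<And>c :: 'n \<Rightarrow> nat. even (\<Sum>k\<in>UNIV. c k) \<Longrightarrow> (\<And>k. CARD('n) - 2 \<le> c k) \<Longrightarrow> \<exists>q\<in>Q. b q \<le> c"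
  shows "(\<Inter>i\<in>K - {l}. twist (s i) ` I_n) = ideal_span (J_n \<union> (\<lambda>q. twist (s l) (p q)) ` Q)"
proof -
  have prime: "prime_ideal (I_n :: ('n, 'k) mpoly set)"
    using prime_ideal_I_n_if_twist primes l by blast
  have mem: "f \<in> twist (s i) ` I_n \<longleftrightarrow> (\<forall>c. fibsum (s i) c f = 0)" for f :: "('n, 'k) mpoly" and i
    by (rule twist_I_n_iff[OF prime])
  have diag: "s i (Upair j j) = s i (Upair k k)" if "i \<in> K" for i j k
    using diagonal_sign_constant[OF char prime] decomp that by blast
  have bij: "bij_betw (\<lambda>i. flips r (s i)) K (Pow (edges r))" for r
  proof -
    have inj: "inj_on (\<lambda>i. flips r (s i)) K"
    proof (rule inj_onI)
      fix i j assume ij: "i \<in> K" "j \<in> K" "flips r (s i) = flips r (s j)"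
      have "twist (s i) ` (I_n :: ('n, 'k) mpoly set) = twist (s j) ` I_n"
        by (rule twist_I_n_eq_if_flips_eq[OF prime diag[OF ij(1)] diag[OF ij(2)] ij(3)])
      then show "i = j" using distinct ij by (auto dest: inj_onD)
    qed
    moreover have "(\<lambda>i. flips r (s i)) ` K = Pow (edges r)"
    proof (rule card_subset_eq)
      show "(\<lambda>i. flips r (s i)) ` K \<subseteq> Pow (edges r)" by (auto simp: flips_def)
      show "card ((\<lambda>i. flips r (s i)) ` K) = card (Pow (edges r))"
        by (simp add: card_image[OF inj] K card_Pow card_edges)
    qed simp
    ultimately show ?thesis by (rule bij_betw_imageI)
  qed
  fix r :: 'n
  \<comment> \<open>The fiber sum at \<open>l\<close> of the multiple by \<open>d\<close>: a sign
    times a power of 2, hence nonzero, so that \<open>g\<close> can divide by it.\<close>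
  define \<alpha> where "\<alpha> q d = (msign (s l) d * fiber_sign r (s l) (b q) * fiber_sign r (s l) (b q) * 2 ^ card (edges r) :: 'k)" for q d
  have \<alpha>: "\<alpha> q d \<noteq> 0" for q d
    unfolding \<alpha>_def using char by (simp add: mult.assoc)
  have fib: "fibsum (s i) c (Poly_Mapping.single d 1 * twist (s l) (p q)) =
      of_bool (c = (\<lambda>k. Vdeg d k + b q k)) * (if i = l then \<alpha> q d else 0)"
    if "i \<in> K" "q \<in> Q" for i c d q
  proof -
    have "flips r (s i) = flips r (s l) \<longleftrightarrow> i = l"
      using bij[of r] that l by (auto simp: bij_betw_def inj_on_def)
    then show ?thesis
      using fibsum_genfun[of "b q" "p q" "s i" r "s l" c d, OF n even_b[OF that(2)] ge_b[OF that(2)]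
          genfun[OF that(2)] diag[OF that(1)] diag[OF l]]
      by (auto simp: \<alpha>_def)
  qed
  show ?thesis
  proof
    let ?S = "J_n \<union> (\<lambda>q. twist (s l) (p q)) ` Q"
    show "ideal_span ?S \<subseteq> (\<Inter>i\<in>K - {l}. twist (s i) ` I_n)"
    proof (rule INT_greatest)
      fix i assume i: "i \<in> K - {l}"
      have "twist (s l) (p q) \<in> twist (s i) ` I_n" if "q \<in> Q" for q
        unfolding mem using fib[of i q _ 0] i that by simp
      then have "?S \<subseteq> twist (s i) ` I_n" using decomp i by auto
      then have "ideal_span ?S \<subseteq> ideal_span (twist (s i) ` I_n)" by (rule ideal_span_mono)
      also have "\<dots> = twist (s i) ` I_n" using primes[of i] i by (simp add: prime_ideal_def)
      finally show "ideal_span ?S \<subseteq> twist (s i) ` I_n" .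
    qed
    show "(\<Inter>i\<in>K - {l}. twist (s i) ` I_n) \<subseteq> ideal_span ?S"
    proof
      fix f :: "('n, 'k) mpoly"
      assume f: "f \<in> (\<Inter>i\<in>K - {l}. twist (s i) ` I_n)"
      then have f0: "fibsum (s i) c f = 0" if "i \<in> K - {l}" for i c
        using that by (auto simp: mem)
      \<comment> \<open>The only degrees in which the fiber sum at \<open>l\<close> can be nonzero,
        as \<open>out\<close> shows.\<close>
      define B where "B = {c \<in> Vdeg ` Poly_Mapping.keys f. \<forall>k. CARD('n) - 2 \<le> c k}"
      have finB: "finite B" by (simp add: B_def)
      \<comment> \<open>A degree occurring in \<open>f\<close> has even sum. So has its difference
        to \<open>b q\<close>, which is therefore the degree of some monomial
        \<open>d\<close>.\<close>
      have "\<exists>q d. q \<in> Q \<and> c = (\<lambda>k. Vdeg d k + b q k)" if "c \<in> B" for c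
      proof -
        have even_c: "even (\<Sum>k\<in>UNIV. c k)" using that by (auto simp: B_def sum_Vdeg)
        then obtain q where q: "q \<in> Q" "b q \<le> c" using cover[of c] \<open>c \<in> B\<close> by (auto simp: B_def)
        have "(\<Sum>k\<in>UNIV. c k - b q k) + (\<Sum>k\<in>UNIV. b q k) = (\<Sum>k\<in>UNIV. c k)"
          using q(2) by (simp add: le_fun_def flip: sum.distrib)
        then have "even (\<Sum>k\<in>UNIV. c k - b q k)" using even_c even_b[OF q(1)] by (metis even_add)
        then obtain d where "Vdeg d = (\<lambda>k. c k - b q k)" using ex_mon_Vdeg by blast
        then show ?thesis using q by (intro exI[of _ q] exI[of _ d]) (auto simp: le_fun_def)
      qed
      then obtain q d where qd: "\<And>c. c \<in> B \<Longrightarrow> q c \<in> Q" "\<And>c. c \<in> B \<Longrightarrow> c = (\<lambda>k. Vdeg (d c) k + b (q c) k)"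
        by metis
      \<comment> \<open>Scaled to have the same fiber sum as \<open>f\<close> at \<open>l\<close> in
        degree \<open>c\<close>; its fiber sums in other degrees and at other components
        vanish.\<close>
      define g where "g c = Poly_Mapping.single 0 (fibsum (s l) c f / \<alpha> (q c) (d c)) *
          (Poly_Mapping.single (d c) 1 * twist (s l) (p (q c)))" for c
      have fg: "fibsum (s i) c' (g c) = (if c = c' \<and> i = l then fibsum (s l) c f else 0)"
        if "i \<in> K" "c \<in> B" for i c c'
        using fib[OF that(1) qd(1)[OF that(2)], of c' "d c"] qd(2)[OF that(2), symmetric] \<alpha>
        by (auto simp: g_def fibsum_scale)
      have out: "fibsum (s l) c f = 0" if "c \<notin> B" for c
      proof (cases "c \<in> Vdeg ` Poly_Mapping.keys f")
        case True
        with that have "\<not> (\<forall>k. CARD('n) - 2 \<le> c k)" by (simp add: B_def)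
        then obtain v where "c v < CARD('n) - 2" by (auto simp: not_le)
        then show ?thesis
          by (rule fibsum_zero_if_not_full[OF _ diag bij f0 l])
      next
        case False
        then show ?thesis
          unfolding fibsum_def wsum_def by (intro sum.neutral) auto
      qed
      have "f - (\<Sum>c\<in>B. g c) \<in> twist (s i) ` I_n" if i: "i \<in> K" for i
        unfolding mem
      proof
        fix c
        have "(\<Sum>c'\<in>B. fibsum (s i) c (g c')) = (\<Sum>c'\<in>B. if c' = c then (if i = l then fibsum (s l) c f else 0) else 0)"
          using fg[OF i] by (intro sum.cong) auto
        also have "\<dots> = fibsum (s i) c f"
          using finB out[of c] f0[of i c] i by auto
        finally show "fibsum (s i) c (f - (\<Sum>c\<in>B. g c)) = 0"
          by (simp add: fibsum_diff fibsum_sum)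
      qed
      then have "f - (\<Sum>c\<in>B. g c) \<in> J_n" using decomp by blast
      then have "f - (\<Sum>c\<in>B. g c) \<in> ideal_span ?S"
        using ideal_span_superset by blast
      moreover have "(\<Sum>c\<in>B. g c) \<in> ideal_span ?S"
      proof (rule ideal_span_sum)
        fix c assume "c \<in> B"
        then have "twist (s l) (p (q c)) \<in> ideal_span ?S"
          using qd(1) by (intro subsetD[OF ideal_span_superset]) auto
        then show "g c \<in> ideal_span ?S"
          unfolding g_def by (intro ideal_span_mult)
      qed
      ultimately show "f \<in> ideal_span ?S"
        using ideal_span_add by fastforce
    qed
  qed
qed

section \<open>Homogeneity and the two parities of \<open>n\<close>\<close>

lemma homogeneous_of_genfun:
  fixes p :: "('n::finite, 'k::comm_ring_1) mpoly"
  assumes "is_genfun (fiber b) p" "d = (\<Sum>k\<in>UNIV. b k) div 2"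
  shows "homogeneous_of d p"
  unfolding homogeneous_of_def
proof
  fix m assume m: "m \<in> Poly_Mapping.keys p"
  from assms(1) obtain A where A: "A \<subseteq> fiber b" "p = (\<Sum>a\<in>A. Poly_Mapping.single a 1)"
    by (rule is_genfunE)
  have "m \<in> (\<Union>a\<in>A. Poly_Mapping.keys (Poly_Mapping.single a (1 :: 'k)))"
    by (rule subsetD[OF Poly_Mapping.keys_sum m[unfolded A(2)]])
  then have "m \<in> A" by simp
  with A(1) have "Vdeg m = b" by (auto simp: fiber_def)
  then show "tdeg m = d" using sum_Vdeg[of m] assms(2) by simp
qed

theorem theorem2p10:
  fixes s :: "nat \<Rightarrow> ('n::finite uprod \<Rightarrow> bool)"
    and l :: nat
  assumes n2: "CARD('n) \<ge> 2"
    and char: "(2::'k::field) \<noteq> 0"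
    and decomp: "(J_n :: ('n, 'k) mpoly set) =
        (\<Inter>i\<in>{1..2 ^ ((CARD('n) - 1) choose 2)}. twist (s i) ` I_n)"
    and primes: "\<forall>i\<in>{1..2 ^ ((CARD('n) - 1) choose 2)}.
        prime_ideal (twist (s i) ` (I_n :: ('n, 'k) mpoly set))"
    and distinct: "\<forall>i\<in>{1..2 ^ ((CARD('n) - 1) choose 2)}. \<forall>j\<in>{1..2 ^ ((CARD('n) - 1) choose 2)}.
        i \<noteq> j \<longrightarrow> twist (s i) ` (I_n :: ('n, 'k) mpoly set) \<noteq> twist (s j) ` I_n"
    and l: "l \<in> {1..2 ^ ((CARD('n) - 1) choose 2)}"
  shows
    "(odd (CARD('n)) \<longrightarrow>
       (\<forall>p :: 'n \<Rightarrow> ('n, 'k) mpoly.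
          (\<forall>i. is_genfun (fiber (\<lambda>k. CARD('n) - 2 + (if k = i then 1 else 0))) (p i)) \<longrightarrow>
          (\<forall>i. homogeneous_of ((CARD('n) - 1)^2 div 2) (p i)) \<and>
          (\<Inter>i\<in>{1..2 ^ ((CARD('n) - 1) choose 2)} - {l}. twist (s i) ` I_n)
            = ideal_span (J_n \<union> range (\<lambda>i. twist (s l) (p i))))) \<and>
     (even (CARD('n)) \<longrightarrow>
       (\<forall>p :: ('n, 'k) mpoly.
          is_genfun (fiber (\<lambda>k. CARD('n) - 2)) p \<longrightarrow>
          homogeneous_of (CARD('n) * (CARD('n) - 2) div 2) p \<and>
          (\<Inter>i\<in>{1..2 ^ ((CARD('n) - 1) choose 2)} - {l}. twist (s i) ` I_n)
            = ideal_span (J_n \<union> {twist (s l) p})))"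
proof -
  have inj: "inj_on (\<lambda>i. twist (s i) ` (I_n :: ('n, 'k) mpoly set)) {1..2 ^ ((CARD('n) - 1) choose 2)}"
    using distinct by (intro inj_onI) blast
  show ?thesis
  proof (intro conjI impI allI)
    fix p :: "'n \<Rightarrow> ('n, 'k) mpoly" and i
    assume odd: "odd (CARD('n))"
      and p: "\<forall>i. is_genfun (fiber (\<lambda>k. CARD('n) - 2 + (if k = i then 1 else 0))) (p i)"
    have sum: "(\<Sum>k\<in>UNIV. CARD('n) - 2 + (if k = i then 1 else 0)) = (CARD('n) - 1)^2" for i :: 'n
    proof -
      have "(\<Sum>k\<in>UNIV. CARD('n) - 2 + (if k = i then 1 else 0)) = CARD('n) * (CARD('n) - 2) + 1"
        by (simp add: sum.distrib)
      also have "\<dots> = (CARD('n) - 1)^2"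
      proof -
        obtain m where m: "CARD('n) = 2 + m" using n2 le_Suc_ex by blast
        show ?thesis unfolding m by (simp add: power2_eq_square)
      qed
      finally show ?thesis .
    qed
    show "homogeneous_of ((CARD('n) - 1)^2 div 2) (p i)"
      using p by (intro homogeneous_of_genfun[of _ "p i"]) (auto simp only: sum)
    \<comment> \<open>For odd \<open>n\<close> the constant vector \<open>n - 2\<close> has odd sum,
      so an admissible degree with even sum exceeds it at some \<open>i\<close>.\<close>
    have cover: "\<exists>i. (\<lambda>k. CARD('n) - 2 + (if k = i then 1 else 0)) \<le> c"
      if c: "even (\<Sum>k\<in>UNIV. c k)" "\<And>k. CARD('n) - 2 \<le> c k" for c :: "'n \<Rightarrow> nat"
    proof -
      have "\<exists>i. c i \<noteq> CARD('n) - 2"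
      proof (rule ccontr)
        assume "\<nexists>i. c i \<noteq> CARD('n) - 2"
        then have "(\<Sum>k\<in>UNIV. c k) = CARD('n) * (CARD('n) - 2)" by simp
        with c(1) odd n2 show False by simp
      qed
      then obtain i where "CARD('n) - 2 < c i" using c(2) by (metis le_neq_implies_less)
      then show ?thesis using c(2) by (auto simp: le_fun_def intro!: exI[of _ i])
    qed
    show "(\<Inter>i\<in>{1..2 ^ ((CARD('n) - 1) choose 2)} - {l}. twist (s i) ` I_n)
        = ideal_span (J_n \<union> range (\<lambda>i. twist (s l) (p i)))"
    proof (rule INT_twist_I_n_eq_ideal_span[OF n2 char _ _ l decomp _ inj])
      show "even (\<Sum>k\<in>UNIV. CARD('n) - 2 + (if k = i then 1 else 0))" for i :: 'n
        unfolding sum using odd n2 by simp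
    qed (use primes p cover in auto)
  next
    fix p :: "('n, 'k) mpoly"
    assume even: "even (CARD('n))" and p: "is_genfun (fiber (\<lambda>k. CARD('n) - 2)) p"
    then show "homogeneous_of (CARD('n) * (CARD('n) - 2) div 2) p"
      by (intro homogeneous_of_genfun) auto
    \<comment> \<open>For even \<open>n\<close> the constant vector \<open>n - 2\<close> itself has
      even sum, and a one-point index set suffices.\<close>
    have "(\<Inter>i\<in>{1..2 ^ ((CARD('n) - 1) choose 2)} - {l}. twist (s i) ` I_n)
        = ideal_span (J_n \<union> (\<lambda>_. twist (s l) p) ` {()})"
    proof (rule INT_twist_I_n_eq_ideal_span[OF n2 char _ _ l decomp _ inj])
      show "is_genfun (fiber (\<lambda>k. CARD('n) - 2)) p" by (rule p)
    qed (use primes even in \<open>auto simp: le_fun_def\<close>)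
    then show "(\<Inter>i\<in>{1..2 ^ ((CARD('n) - 1) choose 2)} - {l}. twist (s i) ` I_n)
        = ideal_span (J_n \<union> {twist (s l) p})"
      by simp
  qed
qed

end
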